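(* In the setting described in the context, for each $v\in V_2$ there is a randomized rule that selects at most one edge among the edges of $R_1\cup R_2\cup R_3$ incident to $v$, such that, letting $M$ be the set of selected edges (a matching in $R(x)$), $\Pr[(u,v)\in M]\ge 0.509\,x_{uv}$ for every edge $(u,v)$.
   Context: $G$ is a bipartite graph with sides $V_1,V_2$ and edge set $E$, and $x\in(0,1]^E$ satisfies $\sum_{v}x_{uv}=1$ for every $u\in V_1$ and $\sum_{u}x_{uv}=1$ for every $v\in V_2$. $R=R(x)$ contains each edge $e$ independently with probability $x_e$. The "red/blue/gray scheme": (1) each edge $(u,v)\in R$ is independently declared active with conditional probability $(1-e^{-x_{uv}})/x_{uv}$; edges of $R$ not active are gray. (2) Each active edge $(u,v)$ that is the only active edge incident to $v$ is independently marked red, with probability chosen so that $\Pr[(u,v)\text{ red}]=1-e^{-x_{uv}/e}$; other active edges are blue. Then, independently for each $u\in V_1$: (3) if there are red edges incident to $u$, one of them is selected into $R_1$ by a rule depending only on the red edges at $u$, with $\Pr[(u,v)\in R_1]=(1-e^{-1/e})x_{uv}$; (4) if there are no red but some blue edges incident to $u$, one of them is selected into $R_2$ by a rule depending only on the set of blue edges at $u$ that is monotone (the probability of selecting a given edge is non-increasing in the blue set containing it), with $\Pr[(u,v)\in R_2]=(e^{-1/e}-e^{-1})x_{uv}$; (5) if there are no active but some gray edges incident to $u$, one of them is selected into $R_3$ by a rule depending only on the gray edges at $u$, with $\Pr[(u,v)\in R_3]\ge\frac{1}{2e}x_{uv}^2$. *)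

theory Defs
  imports "HOL-Probability.Probability"
begin

(* A bipartite graph with sides V1 and V2 is given by finite sets V1 :: 'a set and V2 :: 'b set
   and an edge set E \<subseteq> V1 \<times> V2; the edge between u and v is the pair (u, v). *)

definition edges_at1 :: "('a \<times> 'b) set \<Rightarrow> 'a \<Rightarrow> ('a \<times> 'b) set" where
  "edges_at1 F u = {e \<in> F. fst e = u}"

definition edges_at2 :: "('a \<times> 'b) set \<Rightarrow> 'b \<Rightarrow> ('a \<times> 'b) set" where
  "edges_at2 F v = {e \<in> F. snd e = v}"

definition bipartite_graph :: "'a set \<Rightarrow> 'b set \<Rightarrow> ('a \<times> 'b) set \<Rightarrow> bool" where
  "bipartite_graph V1 V2 E \<longleftrightarrow> finite V1 \<and> finite V2 \<and> E \<subseteq> V1 \<times> V2"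

definition fractional_perfect_matching ::
    "'a set \<Rightarrow> 'b set \<Rightarrow> ('a \<times> 'b) set \<Rightarrow> ('a \<times> 'b \<Rightarrow> real) \<Rightarrow> bool" where
  "fractional_perfect_matching V1 V2 E x \<longleftrightarrow>
     (\<forall>e\<in>E. 0 < x e \<and> x e \<le> 1) \<and>
     (\<forall>u\<in>V1. (\<Sum>e\<in>edges_at1 E u. x e) = 1) \<and>
     (\<forall>v\<in>V2. (\<Sum>e\<in>edges_at2 E v. x e) = 1)"

definition is_matching :: "('a \<times> 'b) set \<Rightarrow> bool" where
  "is_matching M \<longleftrightarrow> (\<forall>e\<in>M. \<forall>f\<in>M. e \<noteq> f \<longrightarrow> fst e \<noteq> fst f \<and> snd e \<noteq> snd f)"

definition random_subset :: "'e set \<Rightarrow> ('e \<Rightarrow> real) \<Rightarrow> 'e set pmf" where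
  "random_subset S p = map_pmf (\<lambda>b. {e \<in> S. b e}) (Pi_pmf S False (\<lambda>e. bernoulli_pmf (p e)))"

definition lone_edges :: "('a \<times> 'b) set \<Rightarrow> ('a \<times> 'b) set" where
  "lone_edges A = {e \<in> A. edges_at2 A (snd e) = {e}}"

(* Joint law of (red, blue, gray); these three sets partition R.
   \<rho> e is the probability of marking e red, given that e is the only active edge at its
   endpoint in V2. *)
definition colouring ::
    "('a \<times> 'b) set \<Rightarrow> ('a \<times> 'b \<Rightarrow> real) \<Rightarrow> ('a \<times> 'b \<Rightarrow> real) \<Rightarrow>
     (('a \<times> 'b) set \<times> ('a \<times> 'b) set \<times> ('a \<times> 'b) set) pmf" where
  "colouring E x \<rho> = do {
     R \<leftarrow> random_subset E x;
     A \<leftarrow> random_subset R (\<lambda>e. (1 - exp (- x e)) / x e);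
     D \<leftarrow> random_subset (lone_edges A) \<rho>;
     return_pmf (D, A - D, R - A)
   }"

(* \<sigma> u S is the law of the edge selected at u from S, a nonempty set of edges at u. *)
definition selection_rule ::
    "'a set \<Rightarrow> ('a \<times> 'b) set \<Rightarrow> ('a \<Rightarrow> ('a \<times> 'b) set \<Rightarrow> ('a \<times> 'b) pmf) \<Rightarrow> bool" where
  "selection_rule V1 E \<sigma> \<longleftrightarrow>
     (\<forall>u\<in>V1. \<forall>S. S \<subseteq> edges_at1 E u \<and> S \<noteq> {} \<longrightarrow> set_pmf (\<sigma> u S) \<subseteq> S)"

definition monotone_rule ::
    "'a set \<Rightarrow> ('a \<times> 'b) set \<Rightarrow> ('a \<Rightarrow> ('a \<times> 'b) set \<Rightarrow> ('a \<times> 'b) pmf) \<Rightarrow> bool" where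
  "monotone_rule V1 E \<sigma> \<longleftrightarrow>
     (\<forall>u\<in>V1. \<forall>S T e. e \<in> S \<and> S \<subseteq> T \<and> T \<subseteq> edges_at1 E u \<longrightarrow> pmf (\<sigma> u T) e \<le> pmf (\<sigma> u S) e)"

(* The contributions of u to (R1, R2, R3), for given red edges D, blue edges B, gray edges Y. *)
definition select_at ::
    "('a \<Rightarrow> ('a \<times> 'b) set \<Rightarrow> ('a \<times> 'b) pmf) \<Rightarrow>
     ('a \<Rightarrow> ('a \<times> 'b) set \<Rightarrow> ('a \<times> 'b) pmf) \<Rightarrow>
     ('a \<Rightarrow> ('a \<times> 'b) set \<Rightarrow> ('a \<times> 'b) pmf) \<Rightarrow>
     ('a \<times> 'b) set \<Rightarrow> ('a \<times> 'b) set \<Rightarrow> ('a \<times> 'b) set \<Rightarrow> 'a \<Rightarrow>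
     (('a \<times> 'b) set \<times> ('a \<times> 'b) set \<times> ('a \<times> 'b) set) pmf" where
  "select_at \<sigma>1 \<sigma>2 \<sigma>3 D B Y u =
     (if edges_at1 D u \<noteq> {} then map_pmf (\<lambda>e. ({e}, {}, {})) (\<sigma>1 u (edges_at1 D u))
      else if edges_at1 B u \<noteq> {} then map_pmf (\<lambda>e. ({}, {e}, {})) (\<sigma>2 u (edges_at1 B u))
      else if edges_at1 Y u \<noteq> {} then map_pmf (\<lambda>e. ({}, {}, {e})) (\<sigma>3 u (edges_at1 Y u))
      else return_pmf ({}, {}, {}))"

(* Joint law of (R, R1, R2, R3). *)
definition rbg_scheme ::
    "'a set \<Rightarrow> ('a \<times> 'b) set \<Rightarrow> ('a \<times> 'b \<Rightarrow> real) \<Rightarrow> ('a \<times> 'b \<Rightarrow> real) \<Rightarrow>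
     ('a \<Rightarrow> ('a \<times> 'b) set \<Rightarrow> ('a \<times> 'b) pmf) \<Rightarrow>
     ('a \<Rightarrow> ('a \<times> 'b) set \<Rightarrow> ('a \<times> 'b) pmf) \<Rightarrow>
     ('a \<Rightarrow> ('a \<times> 'b) set \<Rightarrow> ('a \<times> 'b) pmf) \<Rightarrow>
     (('a \<times> 'b) set \<times> ('a \<times> 'b) set \<times> ('a \<times> 'b) set \<times> ('a \<times> 'b) set) pmf" where
  "rbg_scheme V1 E x \<rho> \<sigma>1 \<sigma>2 \<sigma>3 = do {
     (D, B, Y) \<leftarrow> colouring E x \<rho>;
     s \<leftarrow> Pi_pmf V1 ({}, {}, {}) (select_at \<sigma>1 \<sigma>2 \<sigma>3 D B Y);
     return_pmf (D \<union> B \<union> Y,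
                 \<Union>u\<in>V1. fst (s u), \<Union>u\<in>V1. fst (snd (s u)), \<Union>u\<in>V1. snd (snd (s u)))
   }"

(* \<tau> v S is the law of the edge selected at v (None: no edge), when S is the set of edges of
   R1 \<union> R2 \<union> R3 at v. *)
definition partial_selection_rule ::
    "'b set \<Rightarrow> ('a \<times> 'b) set \<Rightarrow> ('b \<Rightarrow> ('a \<times> 'b) set \<Rightarrow> ('a \<times> 'b) option pmf) \<Rightarrow> bool" where
  "partial_selection_rule V2 E \<tau> \<longleftrightarrow>
     (\<forall>v\<in>V2. \<forall>S. S \<subseteq> edges_at2 E v \<longrightarrow> set_pmf (\<tau> v S) \<subseteq> insert None (Some ` S))"

(* Joint law of (R, M), from the joint law of (R, R1, R2, R3). *)
definition final_selection ::
    "'b set \<Rightarrow> ('b \<Rightarrow> ('a \<times> 'b) set \<Rightarrow> ('a \<times> 'b) option pmf) \<Rightarrow>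
     (('a \<times> 'b) set \<times> ('a \<times> 'b) set \<times> ('a \<times> 'b) set \<times> ('a \<times> 'b) set) pmf \<Rightarrow>
     (('a \<times> 'b) set \<times> ('a \<times> 'b) set) pmf" where
  "final_selection V2 \<tau> scheme = do {
     (R, R1, R2, R3) \<leftarrow> scheme;
     m \<leftarrow> Pi_pmf V2 None (\<lambda>v. \<tau> v (edges_at2 (R1 \<union> R2 \<union> R3) v));
     return_pmf (R, {e. \<exists>v\<in>V2. m v = Some e})
   }"

end

theory Submission
  imports Defs
begin

text \<open>At a vertex \<open>v\<close> of \<open>V2\<close> a rule with ratio \<open>c\<close> exists as soon as \<open>R1 \<union> R2 \<union> R3\<close> meets every set \<open>T\<close> of edges at
  \<open>v\<close> with probability at least \<open>c * x(T)\<close> (fractional Hall theorem); the bound comes from \<open>R1 \<union> R2\<close>.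

  A red edge at \<open>v\<close> is the only active edge at \<open>v\<close>, so \<open>R1\<close> meets \<open>T\<close> with probability
  \<open>(1 - exp (- 1/e)) * x(T)\<close>, disjointly from the event that \<open>R2\<close> meets \<open>T\<close>. For the latter, condition on the
  active edges at \<open>v\<close>. A blue edge at \<open>v\<close> enters \<open>R2\<close> with a probability that depends only on the colours at the
  other vertices of \<open>V2\<close>, and that decreases, by monotonicity of the rule, when an edge at the same vertex of
  \<open>V1\<close> moves up in the order uncoloured, blue, red. For two different vertices of \<open>V1\<close> these colours are
  negatively dependent: being active is independent and being red is exclusive. So any two blue edges at
  \<open>v\<close> hit at least as often as if they were independent. Using one edge when a single edge in \<open>T\<close> is blue and
  two of them otherwise gives a function of \<open>x\<close> on \<open>T\<close> whose worst case is that of infinitesimal edges with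
  \<open>x(T) = 1\<close>, where its value is about \<open>0.5094\<close>.\<close>

section \<open>A fractional Hall theorem\<close>

text \<open>Induction over the edges of \<open>N\<close>: an amount \<open>\<delta>\<close> is
  routed through one edge, the edge is deleted, and the supply and demand at its ends are reduced by
  \<open>\<delta>\<close>. Submodularity of the weight of a neighbourhood guarantees that some
  \<open>\<delta>\<close> preserves the Hall condition.\<close>

lemma fractional_hall:
  fixes N :: "('i \<times> 'j) set" and \<pi> :: "'i \<Rightarrow> real" and y :: "'j \<Rightarrow> real"
  assumes "finite N" and "finite I" and "finite J" and "N \<subseteq> I \<times> J"
    and "\<And>i. i \<in> I \<Longrightarrow> 0 \<le> \<pi> i"
    and "\<And>T. T \<subseteq> J \<Longrightarrow> sum y T \<le> sum \<pi> {i \<in> I. \<exists>j\<in>T. (i, j) \<in> N}"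
  shows "\<exists>\<phi>. (\<forall>i j. 0 \<le> \<phi> i j) \<and> (\<forall>i j. (i, j) \<notin> N \<longrightarrow> \<phi> i j = 0) \<and>
           (\<forall>i\<in>I. (\<Sum>j\<in>J. \<phi> i j) \<le> \<pi> i) \<and> (\<forall>j\<in>J. y j \<le> (\<Sum>i\<in>I. \<phi> i j))"
  using assms
proof (induction N arbitrary: \<pi> y rule: finite_induct)
  case empty
  have "y j \<le> 0" if "j \<in> J" for j using empty.prems(5)[of "{j}"] that by simp
  then show ?case using empty.prems(4) by (intro exI[of _ "\<lambda>_ _. 0"]) auto
next
  case (insert p N)
  obtain i0 j0 where p: "p = (i0, j0)" by (cases p)
  have i0: "i0 \<in> I" and j0: "j0 \<in> J" using insert.prems(3) p by auto
  note finI = insert.prems(1) and finJ = insert.prems(2)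
  define N' where "N' = insert p N"
  define h where "h = (\<lambda>T. sum \<pi> {i \<in> I. \<exists>j\<in>T. (i, j) \<in> N'})"
  define sl where "sl = (\<lambda>T. h T - sum y T)"
  have sl: "sl T \<ge> 0" if "T \<subseteq> J" for T using insert.prems(5)[OF that] by (simp add: sl_def h_def N'_def)
  have pos: "\<pi> i \<ge> 0" if "i \<in> I" for i using insert.prems(4) that .
  text \<open>\<open>L\<close> and \<open>U\<close> collect the sets whose Hall condition bounds the flow through \<open>(i0, j0)\<close>
    from below and from above when that edge is deleted.\<close>
  define L where "L = {T. T \<subseteq> J \<and> j0 \<in> T \<and> (\<forall>j\<in>T. (i0, j) \<notin> N)}"
  define U where "U = {T. T \<subseteq> J \<and> j0 \<notin> T \<and> (\<exists>j\<in>T. (i0, j) \<in> N)}"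
  \<comment> \<open>The element \<open>0\<close> makes the flow nonnegative and keeps the maximum
    defined when \<open>L\<close> is empty; \<open>\<delta>\<close> is the least flow meeting every
    lower bound.\<close>
  define lows where "lows = insert 0 ((\<lambda>T. \<pi> i0 - sl T) ` L)"
  define \<delta> where "\<delta> = Max lows"
  have finL: "finite L" and finU: "finite U" using finJ by (auto simp: L_def U_def)
  have fl: "finite lows" "lows \<noteq> {}" using finL by (auto simp: lows_def)
  have \<delta>0: "\<delta> \<ge> 0" unfolding \<delta>_def using fl by (intro Max_ge) (auto simp: lows_def)
  have \<delta>L: "\<delta> \<ge> \<pi> i0 - sl T" if "T \<in> L" for T
    unfolding \<delta>_def using fl that by (intro Max_ge) (auto simp: lows_def)
  have \<delta>\<pi>: "\<delta> \<le> \<pi> i0"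
    unfolding \<delta>_def using fl sl pos[OF i0] by (subst Max_le_iff) (auto simp: lows_def L_def)
  have \<delta>U: "\<delta> \<le> sl T'" if T': "T' \<in> U" for T'
  proof -
    have "\<pi> i0 - sl T \<le> sl T'" if T: "T \<in> L" for T
    proof -
      have sub: "T \<subseteq> J" "T' \<subseteq> J" using T T' by (auto simp: L_def U_def)
      have fT: "finite T" "finite T'" using sub finJ by (auto intro: finite_subset)
      have "sl (T \<union> T') \<ge> 0" "sl (T \<inter> T') \<ge> 0" using sub by (auto intro!: sl)
      moreover have "sum y T + sum y T' = sum y (T \<union> T') + sum y (T \<inter> T')"
        using fT by (simp add: sum.union_inter)
      \<comment> \<open>Submodularity with a gain of \<open>\<pi> i0\<close>: the vertex
        \<open>i0\<close> is a neighbour of \<open>T\<close> (through \<open>j0\<close>) and of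
        \<open>T'\<close>, but not of \<open>T \<inter> T'\<close>.\<close>
      moreover have "h T + h T' \<ge> h (T \<union> T') + h (T \<inter> T') + \<pi> i0"
      proof -
        let ?A = "\<lambda>T. {i \<in> I. \<exists>j\<in>T. (i, j) \<in> N'}"
        have "h T + h T' = sum \<pi> (?A T \<union> ?A T') + sum \<pi> (?A T \<inter> ?A T')"
          unfolding h_def using finI by (intro sum.union_inter [symmetric]) auto
        moreover have "?A T \<union> ?A T' = ?A (T \<union> T')" by auto
        moreover have "sum \<pi> (insert i0 (?A (T \<inter> T'))) \<le> sum \<pi> (?A T \<inter> ?A T')"
          using T T' finI pos i0 by (intro sum_mono2) (auto simp: L_def U_def N'_def p)
        moreover have "i0 \<notin> ?A (T \<inter> T')" using T T' by (auto simp: L_def U_def N'_def p)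
        ultimately show ?thesis using finI by (simp add: h_def)
      qed
      ultimately show ?thesis by (simp add: sl_def)
    qed
    thus ?thesis unfolding \<delta>_def using fl sl T' by (subst Max_le_iff) (auto simp: lows_def U_def)
  qed
  define \<pi>' where "\<pi>' = \<pi>(i0 := \<pi> i0 - \<delta>)"
  define y' where "y' = y(j0 := y j0 - \<delta>)"
  have "\<exists>\<phi>. (\<forall>i j. 0 \<le> \<phi> i j) \<and> (\<forall>i j. (i, j) \<notin> N \<longrightarrow> \<phi> i j = 0) \<and>
           (\<forall>i\<in>I. (\<Sum>j\<in>J. \<phi> i j) \<le> \<pi>' i) \<and> (\<forall>j\<in>J. y' j \<le> (\<Sum>i\<in>I. \<phi> i j))"
  proof (rule insert.IH)
    show "finite I" "finite J" by fact+
    show "N \<subseteq> I \<times> J" using insert.prems(3) by auto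
    show "0 \<le> \<pi>' i" if "i \<in> I" for i using that pos \<delta>\<pi> by (auto simp: \<pi>'_def)
    fix T assume T: "T \<subseteq> J"
    have fT: "finite T" using T finJ by (auto intro: finite_subset)
    let ?B = "{i \<in> I. \<exists>j\<in>T. (i, j) \<in> N}" and ?A = "{i \<in> I. \<exists>j\<in>T. (i, j) \<in> N'}"
    have fB: "finite ?B" "finite ?A" using finI by auto
    have y': "sum y' T = sum y T - (if j0 \<in> T then \<delta> else 0)"
      unfolding y'_def using fT by (auto simp: sum.remove[of T j0] intro!: sum.cong)
    have \<pi>': "sum \<pi>' ?B = sum \<pi> ?B - (if i0 \<in> ?B then \<delta> else 0)"
    proof (cases "i0 \<in> ?B")
      case True
      have "sum \<pi>' ?B = \<pi>' i0 + sum \<pi>' (?B - {i0})" using fB True by (simp add: sum.remove)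
      also have "sum \<pi>' (?B - {i0}) = sum \<pi> (?B - {i0})" by (intro sum.cong) (auto simp: \<pi>'_def)
      also have "sum \<pi> (?B - {i0}) = sum \<pi> ?B - \<pi> i0" using fB True by (simp add: sum_diff1)
      finally show ?thesis using True by (simp add: \<pi>'_def)
    next
      case False
      then show ?thesis by (auto simp: \<pi>'_def intro!: sum.cong)
    qed
    have A: "sum \<pi> ?A = sum y T + sl T" by (simp add: sl_def h_def)
    have AB: "?A = (if j0 \<in> T then insert i0 ?B else ?B)" using i0 by (auto simp: N'_def p)
    \<comment> \<open>If \<open>j0 \<in> T\<close> and \<open>i0 \<in> ?B\<close>, both sides drop
      by \<open>\<delta>\<close>; if neither holds, both stay. Otherwise either only the demand
      drops and \<open>T\<close> lies in \<open>L\<close>, or only the supply drops and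
      \<open>T\<close> lies in \<open>U\<close>.\<close>
    show "sum y' T \<le> sum \<pi>' ?B"
    proof (cases "j0 \<in> T")
      case True
      show ?thesis
      proof (cases "i0 \<in> ?B")
        case t: True
        have "?A = ?B" using AB True t by auto
        then show ?thesis using A sl[OF T] True t y' \<pi>' by simp
      next
        case f: False
        have "T \<in> L" using True T f i0 by (auto simp: L_def)
        have "sum \<pi> ?A = \<pi> i0 + sum \<pi> ?B" using AB True f fB by simp
        moreover have "sum \<pi>' ?B = sum \<pi> ?B" using \<pi>' f by (simp only: if_False)
        ultimately show ?thesis using A \<delta>L[OF \<open>T \<in> L\<close>] True y' by simp
      qed
    next
      case False
      have "?A = ?B" using AB False by auto
      show ?thesis
      proof (cases "i0 \<in> ?B")
        case t: True
        have "T \<in> U" using False T t by (auto simp: U_def)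
        then show ?thesis using A \<delta>U[OF \<open>T \<in> U\<close>] \<open>?A = ?B\<close> False t y' \<pi>' by simp
      next
        case f: False
        have "sum \<pi>' ?B = sum \<pi> ?B" using \<pi>' f by (simp only: if_False)
        then show ?thesis using A sl[OF T] \<open>?A = ?B\<close> False y' by simp
      qed
    qed
  qed
  then obtain \<phi> where \<phi>: "\<And>i j. 0 \<le> \<phi> i j" "\<And>i j. (i, j) \<notin> N \<Longrightarrow> \<phi> i j = 0"
    "\<And>i. i \<in> I \<Longrightarrow> (\<Sum>j\<in>J. \<phi> i j) \<le> \<pi>' i" "\<And>j. j \<in> J \<Longrightarrow> y' j \<le> (\<Sum>i\<in>I. \<phi> i j)" by blast
  define \<psi> where "\<psi> = (\<lambda>i j. \<phi> i j + (if i = i0 \<and> j = j0 then \<delta> else 0))"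
  have "(\<Sum>j\<in>J. \<psi> i j) = (\<Sum>j\<in>J. \<phi> i j) + (if i = i0 then \<delta> else 0)" for i
    using finJ j0 by (auto simp: \<psi>_def sum.distrib)
  moreover have col: "(\<Sum>i\<in>I. \<psi> i j) = (\<Sum>i\<in>I. \<phi> i j) + (if j = j0 then \<delta> else 0)" for j
    using finI i0 by (auto simp: \<psi>_def sum.distrib)
  ultimately have "(\<Sum>j\<in>J. \<psi> i j) \<le> \<pi> i" if "i \<in> I" for i
    using \<phi>(3)[OF that] by (cases "i = i0") (auto simp: \<pi>'_def)
  moreover have "y j \<le> (\<Sum>i\<in>I. \<psi> i j)" if "j \<in> J" for j
    using \<phi>(4)[OF that] col by (cases "j = j0") (auto simp: y'_def)
  moreover have "0 \<le> \<psi> i j" for i j using \<phi>(1)[of i j] \<delta>0 by (simp add: \<psi>_def)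
  moreover have "\<psi> i j = 0" if "(i, j) \<notin> insert p N" for i j
    using \<phi>(2)[of i j] that by (auto simp: \<psi>_def p)
  ultimately show ?case by (intro exI[of _ \<psi>]) blast
qed

text \<open>Hall's theorem for the graph joining each possible value \<open>X\<close> of
  \<open>S\<close>, with supply \<open>pmf S X\<close>, to its elements \<open>e\<close>, with
  demand \<open>y e\<close>. Dividing the flow out of \<open>X\<close> by \<open>pmf S X\<close>
  gives the selection probabilities given \<open>X\<close>.\<close>

lemma selection_exists:
  fixes S :: "'e set pmf" and y :: "'e \<Rightarrow> real"
  assumes F: "finite F" and y: "\<And>e. e \<in> F \<Longrightarrow> 0 \<le> y e"
    and hit: "\<And>T. T \<subseteq> F \<Longrightarrow> sum y T \<le> measure_pmf.prob S {X. X \<inter> T \<noteq> {}}"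
    and supp: "set_pmf S \<subseteq> Pow F"
  shows "\<exists>\<tau> :: 'e set \<Rightarrow> 'e option pmf. (\<forall>X. X \<subseteq> F \<longrightarrow> set_pmf (\<tau> X) \<subseteq> insert None (Some ` X)) \<and>
            (\<forall>e\<in>F. y e \<le> measure_pmf.expectation S (\<lambda>X. pmf (\<tau> X) (Some e)))"
proof -
  define N where "N = {(X, e). X \<in> Pow F \<and> e \<in> X}"
  have fP: "finite (Pow F)" using F by simp
  have "\<exists>\<phi>. (\<forall>i j. 0 \<le> \<phi> i j) \<and> (\<forall>i j. (i, j) \<notin> N \<longrightarrow> \<phi> i j = 0) \<and>
           (\<forall>i\<in>Pow F. (\<Sum>j\<in>F. \<phi> i j) \<le> pmf S i) \<and> (\<forall>j\<in>F. y j \<le> (\<Sum>i\<in>Pow F. \<phi> i j))"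
  proof (rule fractional_hall)
    show "N \<subseteq> Pow F \<times> F" by (auto simp: N_def)
    then show "finite N" by (rule finite_subset) (use F in auto)
    fix T assume T: "T \<subseteq> F"
    have "measure_pmf.prob S {X. X \<inter> T \<noteq> {}} = measure_pmf.prob S {i \<in> Pow F. \<exists>j\<in>T. (i, j) \<in> N}"
      using supp T by (intro measure_prob_cong_0) (auto simp: N_def pmf_eq_0_set_pmf)
    also have "\<dots> = sum (pmf S) {i \<in> Pow F. \<exists>j\<in>T. (i, j) \<in> N}"
      using fP by (intro measure_measure_pmf_finite) auto
    finally show "sum y T \<le> sum (pmf S) {i \<in> Pow F. \<exists>j\<in>T. (i, j) \<in> N}" using hit[OF T] by simp
  qed (use F in auto)
  then obtain \<phi> where \<phi>: "\<And>i j. 0 \<le> \<phi> i j" "\<And>i j. (i, j) \<notin> N \<Longrightarrow> \<phi> i j = 0"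
    "\<And>i. i \<in> Pow F \<Longrightarrow> (\<Sum>j\<in>F. \<phi> i j) \<le> pmf S i" "\<And>j. j \<in> F \<Longrightarrow> y j \<le> (\<Sum>i\<in>Pow F. \<phi> i j)"
    by blast
  \<comment> \<open>Division by zero yields \<open>0\<close>, so a set \<open>X\<close> of
    probability zero gets no weight.\<close>
  define w where "w = (\<lambda>X e. \<phi> X e / pmf S X)"
  have w0: "w X e \<ge> 0" for X e using \<phi>(1) by (simp add: w_def)
  have wz: "w X e = 0" if "X \<subseteq> F" "e \<notin> X" for X e using that \<phi>(2)[of X e] by (auto simp: w_def N_def)
  have w1: "(\<Sum>e\<in>F. w X e) \<le> 1" if "X \<subseteq> F" for X
    using \<phi>(3)[of X] that by (cases "pmf S X = 0") (auto simp: w_def simp flip: sum_divide_distrib)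
  \<comment> \<open>The mass that the flow leaves unassigned goes to \<open>None\<close>.\<close>
  define m where "m = (\<lambda>X o'. case o' of None \<Rightarrow> 1 - (\<Sum>e\<in>F. w X e) | Some e \<Rightarrow> if e \<in> F then w X e else 0)"
  have ex: "\<exists>p. \<forall>o'. pmf p o' = m X o'" if X: "X \<subseteq> F" for X
  proof -
    have nn: "0 \<le> m X o'" for o' using w0 w1[OF X] by (auto simp: m_def split: option.splits)
    have "(\<integral>\<^sup>+o'. ennreal (m X o') \<partial>count_space UNIV)
        = (\<integral>\<^sup>+o'. ennreal (m X o') \<partial>count_space (insert None (Some ` F)))"
      by (intro nn_integral_count_space_eq) (auto simp: m_def split: option.splits)
    also have "\<dots> = (\<Sum>o'\<in>insert None (Some ` F). ennreal (m X o'))"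
      using F by (intro nn_integral_count_space_finite) auto
    also have "\<dots> = ennreal (\<Sum>o'\<in>insert None (Some ` F). m X o')"
      using nn by (intro sum_ennreal) auto
    also have "(\<Sum>o'\<in>insert None (Some ` F). m X o') = 1"
      using F by (subst sum.insert) (auto simp: m_def sum.reindex)
    finally have "pmf (embed_pmf (m X)) o' = m X o'" for o' using nn by (intro pmf_embed_pmf) auto
    thus ?thesis by blast
  qed
  define \<tau> where "\<tau> = (\<lambda>X. SOME p. \<forall>o'. pmf p o' = m X o')"
  have \<tau>: "pmf (\<tau> X) o' = m X o'" if "X \<subseteq> F" for X o'
    using someI_ex[OF ex[OF that]] by (simp add: \<tau>_def)
  show ?thesis
  proof (intro exI[of _ \<tau>] conjI allI impI ballI)
    fix X assume X: "X \<subseteq> F"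
    show "set_pmf (\<tau> X) \<subseteq> insert None (Some ` X)"
    proof
      fix o' assume "o' \<in> set_pmf (\<tau> X)"
      hence "m X o' \<noteq> 0" using \<tau>[OF X] by (simp add: set_pmf_iff)
      thus "o' \<in> insert None (Some ` X)"
        using wz[OF X] by (auto simp: m_def split: option.splits if_splits)
    qed
  next
    fix e assume e: "e \<in> F"
    have "y e \<le> (\<Sum>X\<in>Pow F. \<phi> X e)" using \<phi>(4) e by simp
    also have "\<dots> = (\<Sum>X\<in>Pow F. pmf (\<tau> X) (Some e) * pmf S X)"
    proof (intro sum.cong refl)
      fix X assume "X \<in> Pow F"
      hence X: "X \<subseteq> F" by simp
      show "\<phi> X e = pmf (\<tau> X) (Some e) * pmf S X"
      proof (cases "pmf S X = 0")
        \<comment> \<open>A set of probability zero has no supply, so no flow leaves it.\<close>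
        case True
        have "\<phi> X e \<le> (\<Sum>j\<in>F. \<phi> X j)" using F e \<phi>(1) by (intro member_le_sum) auto
        with True \<phi>(1)[of X e] \<phi>(3)[of X] X show ?thesis by auto
      next
        case False
        thus ?thesis using \<tau>[OF X] e by (simp add: m_def w_def)
      qed
    qed
    also have "\<dots> = measure_pmf.expectation S (\<lambda>X. pmf (\<tau> X) (Some e))"
      using supp fP by (intro integral_measure_pmf_real [symmetric]) auto
    finally show "y e \<le> measure_pmf.expectation S (\<lambda>X. pmf (\<tau> X) (Some e))" .
  qed
qed

section \<open>Numerical estimates\<close>

text \<open>For an edge with \<open>x e \<rightarrow> 0\<close>, \<open>q0\<close> is the limit of the probability that the edge enters \<open>R2\<close> given that
  it is blue, \<open>Q0\<close> is the probability that at least one of two such independent edges enters \<open>R2\<close>, and \<open>k0\<close>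
  measures the first-order gain over \<open>Q0\<close> for positive \<open>x\<close>.\<close>
definition inv_e :: real where "inv_e = exp (- 1)"
definition q0 :: real where "q0 = (exp (- inv_e) - inv_e) / (1 - inv_e)"
definition Q0 :: real where "Q0 = 2 * q0 - q0\<^sup>2"
definition k0 :: real where "k0 = q0 * (1 - q0) / 4"

section \<open>Taylor polynomial bounds for the exponential\<close>

lemma exp_minus_lower4:
  fixes z :: real assumes "0 \<le> z" shows "exp (- z) \<ge> 1 - z + z^2/2 - z^3/6"
proof -
  obtain t where "exp (-z) = (\<Sum>m<4. (-z)^m / fact m) + exp t / fact 4 * (-z)^4"
    using Maclaurin_exp_le[of "-z" 4] by auto
  \<comment> \<open>At even order the Lagrange remainder is nonnegative; the odd orders in
    \<open>exp_minus_upper3\<close> and \<open>exp_minus_upper5\<close> make it nonpositive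
    instead.\<close>
  moreover have "exp t / fact 4 * (-z)^4 \<ge> 0" by simp
  ultimately show ?thesis by (simp add: eval_nat_numeral)
qed

lemma exp_minus_upper3:
  fixes z :: real assumes "0 \<le> z" shows "exp (- z) \<le> 1 - z + z^2/2"
proof -
  obtain t where "exp (-z) = (\<Sum>m<3. (-z)^m / fact m) + exp t / fact 3 * (-z)^3"
    using Maclaurin_exp_le[of "-z" 3] by auto
  moreover have "exp t / fact 3 * (-z)^3 \<le> 0" using assms by (simp add: mult_nonneg_nonpos)
  ultimately show ?thesis by (simp add: eval_nat_numeral)
qed

lemma exp_minus_upper5:
  fixes z :: real assumes "0 \<le> z" shows "exp (- z) \<le> 1 - z + z^2/2 - z^3/6 + z^4/24"
proof -
  obtain t where "exp (-z) = (\<Sum>m<5. (-z)^m / fact m) + exp t / fact 5 * (-z)^5"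
    using Maclaurin_exp_le[of "-z" 5] by auto
  moreover have "exp t / fact 5 * (-z)^5 \<le> 0" using assms by (simp add: mult_nonneg_nonpos)
  ultimately show ?thesis by (simp add: eval_nat_numeral)
qed

lemma exp_lower3:
  fixes x :: real assumes "0 \<le> x" shows "exp x \<ge> 1 + x + x^2/2"
proof -
  obtain t where "exp x = (\<Sum>m<3. x^m / fact m) + exp t / fact 3 * x^3"
    using Maclaurin_exp_le[of x 3] by auto
  moreover have "exp t / fact 3 * x^3 \<ge> 0" using assms by simp
  ultimately show ?thesis by (simp add: eval_nat_numeral)
qed

lemma exp_upper3:
  fixes x :: real assumes "0 \<le> x" "x \<le> 1" shows "exp x \<le> 1 + x + x^2/2 + 3/10 * x^3"
proof -
  obtain t where t: "\<bar>t\<bar> \<le> \<bar>x\<bar>" "exp x = (\<Sum>m<4. x^m / fact m) + exp t / fact 4 * x^4"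
    using Maclaurin_exp_le[of x 4] by auto
  \<comment> \<open>The remainder is at most \<open>3/24 * x^3\<close>, and
    \<open>1/6 + 3/24 = 7/24\<close> is below the rounded coefficient \<open>3/10\<close>.\<close>
  have "exp t \<le> exp 1" using t(1) assms by simp
  hence "exp t \<le> 3" using exp_le by linarith
  moreover have "x^4 \<le> x^3" using assms by (simp add: power_decreasing)
  ultimately have "exp t * x^4 \<le> 3 * x^3"
    using assms by (intro mult_mono) auto
  moreover have "exp x = 1 + x + x^2/2 + x^3/6 + exp t * x^4 / 24"
    using t(2) by (simp add: eval_nat_numeral)
  moreover have "0 \<le> x^3" using assms by simp
  ultimately show ?thesis by linarith
qed

section \<open>Numerical values of the constants\<close>

lemma inv_e_bounds: "0.36787 \<le> inv_e" "inv_e \<le> 0.36788"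
proof -
  have e: "exp (1::real) \<ge> 2.7182818" "exp (1::real) \<le> 2.7182819" using e_approx_32 by (auto simp: abs_if split: if_splits)
  have "inv_e = 1 / exp 1" by (simp add: inv_e_def exp_minus inverse_eq_divide)
  moreover have "0.36787 * exp 1 \<le> (1::real)" "1 \<le> 0.36788 * exp (1::real)" using e by simp_all
  ultimately show "0.36787 \<le> inv_e" "inv_e \<le> 0.36788"
    by (metis exp_gt_zero pos_le_divide_eq, metis exp_gt_zero pos_divide_le_eq)
qed

lemma exp_inv_e_bounds: "0.692 \<le> exp (- inv_e)" "exp (- inv_e) \<le> 0.6923"
proof -
  have p: "inv_e^2 \<ge> 0.36787^2" "inv_e^2 \<le> 0.36788^2" "inv_e^3 \<ge> 0.36787^3" "inv_e^3 \<le> 0.36788^3" "inv_e^4 \<le> 0.36788^4"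
    using inv_e_bounds by (auto intro!: power_mono)
  obtain t where "exp (- inv_e) = (\<Sum>m<6. (-inv_e)^m / fact m) + exp t / fact 6 * (-inv_e)^6"
    using Maclaurin_exp_le[of "-inv_e" 6] by auto
  moreover have "exp t / fact 6 * (-inv_e)^6 \<ge> 0" by simp
  ultimately have l: "exp (- inv_e) \<ge> 1 - inv_e + inv_e^2/2 - inv_e^3/6 + inv_e^4/24 - inv_e^5/120" by (simp add: eval_nat_numeral)
  have p2: "inv_e^4 \<ge> 0.36787^4" "inv_e^5 \<le> 0.36788^5"
    using inv_e_bounds by (auto intro!: power_mono)
  show "0.692 \<le> exp (- inv_e)" using l p p2 inv_e_bounds by (simp add: power_divide)
  have "exp (- inv_e) \<le> 1 - inv_e + inv_e^2/2 - inv_e^3/6 + inv_e^4/24"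
    using inv_e_bounds by (intro exp_minus_upper5) auto
  thus "exp (- inv_e) \<le> 0.6923" using p inv_e_bounds by (simp add: power_divide)
qed

lemma q0_bounds: "0.5127 \<le> q0" "q0 \<le> 0.5133"
  using inv_e_bounds exp_inv_e_bounds unfolding q0_def by (simp_all add: field_simps)

lemma k0_bounds: "0.0624 \<le> k0" "k0 \<le> 0.0625"
proof -
  \<comment> \<open>As \<open>q0\<close> is close to \<open>1/2\<close>, where
    \<open>q0 * (1 - q0)\<close> is stationary, the second factor is small and the rough bounds on
    \<open>q0\<close> suffice.\<close>
  have *: "k0 - 0.5127 * (1 - 0.5127) / 4 = (q0 - 0.5127) * (1 - 0.5127 - q0) / 4"
    by (simp add: k0_def field_simps power2_eq_square)
  have "\<bar>(q0 - 0.5127) * (1 - 0.5127 - q0)\<bar> \<le> 0.0006 * 0.03"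
    unfolding abs_mult using q0_bounds by (intro mult_mono) auto
  with * show "0.0624 \<le> k0" by (simp add: abs_if split: if_splits)
  have "0 \<le> (2 * q0 - 1)^2" by simp
  thus "k0 \<le> 0.0625" by (simp add: k0_def algebra_simps power2_eq_square)
qed

text \<open>The excess of the contribution of one edge over its value in the limit of infinitesimal edges. Replacing
  \<open>exp (- t)\<close> by the tangent line at \<open>t = 1\<close> reduces the claim to \<open>t = 1\<close>, where the term with \<open>k0\<close> is needed
  to make the coefficient of \<open>x^2\<close> positive.\<close>
lemma edge_excess_nonneg:
  fixes x t :: real
  assumes "0 \<le> x" "x \<le> t" "t \<le> 1"
  shows "exp (- t) * (q0 * x / 2 * (exp x - 1) - 4 * k0 * (exp x - 1 - x))
          - q0 * (1 + x / 2) * (1 - exp (- inv_e * x)) + q0 * inv_e * x + exp (- t) * (k0 * x^2 * (t - x)) \<ge> 0"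
proof -
  define r where "r = exp x - 1 - x"
  define K where "K = q0 * x / 2 * (exp x - 1) - 4 * k0 * r"
  define a where "a = inv_e"
  have a: "0.36787 \<le> a" "a \<le> 0.36788" using inv_e_bounds by (simp_all add: a_def)
  have r: "x^2/2 \<le> r" "r \<le> x^2/2 + 3/10 * x^3"
    using exp_lower3[of x] exp_upper3[of x] assms by (auto simp: r_def)
  have x1: "x \<le> 1" using assms by simp
  \<comment> \<open>In terms of the second-order remainder \<open>r\<close>, the coefficient of
    \<open>x^2\<close> in \<open>K\<close> becomes at least \<open>q0/2 - 2 * k0\<close>, about
    \<open>0.13\<close>, well above \<open>k0\<close>.\<close>
  have "K = q0 * x^2 / 2 + q0 * x / 2 * r - 4 * k0 * r"
    by (simp add: K_def r_def field_simps power2_eq_square)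
  moreover have "q0 * x / 2 * r \<ge> q0 * x / 2 * (x^2/2)"
    using r q0_bounds assms by (intro mult_left_mono) auto
  moreover have "4 * k0 * r \<le> 4 * k0 * (x^2/2 + 3/10 * x^3)"
    using r k0_bounds by (intro mult_left_mono) auto
  ultimately have K: "K \<ge> x^2 * (q0/2 - 2 * k0 + x * (q0/4 - 6/5 * k0))"
    by (simp add: algebra_simps power2_eq_square power3_eq_cube)
  have "q0/2 - 2 * k0 + x * (q0/4 - 6/5 * k0) \<ge> k0"
  proof -
    have "x * (q0/4 - 6/5 * k0) \<ge> 0" using assms q0_bounds k0_bounds by simp
    thus ?thesis using q0_bounds k0_bounds by linarith
  qed
  from mult_left_mono[OF this, of "x^2"] K have Kk: "K \<ge> k0 * x^2" by (simp add: mult.commute)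
  have nn: "k0 * x^2 \<ge> 0" using k0_bounds by simp
  have nn2: "k0 * x^2 * (t - x) \<ge> 0" using nn assms by simp
  have "exp (- t) \<ge> a * (2 - t)"
  proof -
    have "a * (1 + (1 - t)) \<le> a * exp (1 - t)"
      using exp_ge_add_one_self[of "1 - t"] a by (intro mult_left_mono) auto
    also have "\<dots> = exp (- t)" by (simp add: a_def inv_e_def flip: exp_add)
    finally show ?thesis by simp
  qed
  hence "exp (- t) * (K + k0 * x^2 * (t - x)) \<ge> a * (2 - t) * (K + k0 * x^2 * (t - x))"
    using Kk nn nn2 by (intro mult_right_mono) auto
  \<comment> \<open>With the tangent line in place of the exponential, the product is smallest at
    \<open>t = 1\<close>: its excess over the value there is a product of nonnegative
    factors.\<close>
  moreover have "(2 - t) * (K + k0 * x^2 * (t - x)) - (K + k0 * x^2 * (1 - x))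
      = (1 - t) * (K - k0 * x^2 + k0 * x^2 * (t - x))"
    by (simp add: algebra_simps)
  moreover have "(1 - t) * (K - k0 * x^2 + k0 * x^2 * (t - x)) \<ge> 0"
    using Kk nn2 assms by (intro mult_nonneg_nonneg) auto
  ultimately have *: "exp (- t) * (K + k0 * x^2 * (t - x)) \<ge> a * ((2 - t) * (K + k0 * x^2 * (t - x)))"
      and **: "K + k0 * x^2 * (1 - x) \<le> (2 - t) * (K + k0 * x^2 * (t - x))"
    by (simp_all add: mult.assoc)
  have "exp (- t) * (K + k0 * x^2 * (t - x)) \<ge> a * (K + k0 * x^2 * (1 - x))"
    by (rule order_trans[OF mult_left_mono[OF **] *]) (use a in simp)
  moreover have "q0 * (1 + x / 2) * (1 - exp (- a * x)) \<le>
      q0 * (1 + x / 2) * (a * x - (a * x)^2 / 2 + (a * x)^3 / 6)"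
    using exp_minus_lower4[of "a * x"] a assms q0_bounds by (intro mult_left_mono) auto
  moreover have "a * (K + k0 * x^2 * (1 - x)) - q0 * (1 + x / 2) * (a * x - (a * x)^2 / 2 + (a * x)^3 / 6)
      + q0 * a * x \<ge> 0"
  proof -
    have 1: "a * (K + k0 * x^2 * (1 - x)) \<ge> a * (x^2 * (q0/2 - 2 * k0 + x * (q0/4 - 6/5 * k0)) + k0 * x^2 * (1 - x))"
      using K a by (intro mult_left_mono) auto
    have 2: "a * (x^2 * (q0/2 - 2 * k0 + x * (q0/4 - 6/5 * k0)) + k0 * x^2 * (1 - x))
       - q0 * (1 + x / 2) * (a * x - (a * x)^2 / 2 + (a * x)^3 / 6) + q0 * a * x
       = a * x^2 * (q0 * a / 2 - k0 + x * (q0 / 4 - 11/5 * k0 + q0 * a / 4 - q0 * a^2 / 6) - q0 * a^2 * x^2 / 12)"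
      by (simp add: field_simps eval_nat_numeral)
    \<comment> \<open>The constant part \<open>q0 * a / 2 - k0\<close> is about \<open>0.03\<close>,
      whereas the negative quadratic term is below \<open>0.006\<close> in absolute value.\<close>
    have "q0 * a / 2 - k0 + x * (q0 / 4 - 11/5 * k0 + q0 * a / 4 - q0 * a^2 / 6) - q0 * a^2 * x^2 / 12 \<ge> 0"
    proof -
      have u: "q0 * a \<ge> 0.5127 * 0.36787" using q0_bounds a by (intro mult_mono) auto
      have w: "q0 * a^2 \<le> 0.5133 * 0.36788^2" using q0_bounds a by (intro mult_mono power_mono) auto
      hence w': "q0 * a^2 \<le> 0.07" by (simp add: power_divide)
      have "x * (q0 / 4 - 11/5 * k0 + q0 * a / 4 - q0 * a^2 / 6) \<ge> 0"
        using u w' q0_bounds k0_bounds assms by (intro mult_nonneg_nonneg) auto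
      moreover have "q0 * a^2 * x^2 \<le> 0.07 * 1"
        using w' q0_bounds a x1 assms by (intro mult_mono) (auto simp: power_le_one)
      ultimately show ?thesis using u k0_bounds by simp
    qed
    hence "a * x^2 * (q0 * a / 2 - k0 + x * (q0 / 4 - 11/5 * k0 + q0 * a / 4 - q0 * a^2 / 6) - q0 * a^2 * x^2 / 12) \<ge> 0"
      using a by (intro mult_nonneg_nonneg) auto
    with 1 2 show ?thesis by linarith
  qed
  ultimately show ?thesis unfolding K_def r_def a_def by (simp add: algebra_simps)
qed

text \<open>The denominator is the probability that an edge of weight \<open>x\<close> is blue.
  Taylor bounds show that it is at most \<open>(1 - inv_e) * x / (1 + x / 2)\<close>, which yields
  the gain \<open>x / 2\<close> over the infinitesimal rate \<open>q0\<close>.\<close>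

lemma rate_lower:
  fixes x :: real
  assumes "0 < x" "x \<le> 1"
  shows "(exp (- inv_e) - inv_e) * x / (exp (- inv_e * x) - exp (- x)) \<ge> q0 * (1 + x / 2)"
proof -
  define a where "a = inv_e"
  have a: "0.36787 \<le> a" "a \<le> 0.36788" using inv_e_bounds by (simp_all add: a_def)
  have pos: "exp (- a * x) - exp (- x) > 0" using assms a by simp
  have "exp (- a * x) - exp (- x) \<le> (1 - a * x + (a * x)^2/2) - (1 - x + x^2/2 - x^3/6)"
    using exp_minus_upper3[of "a * x"] exp_minus_lower4[of x] assms a by simp
  hence "(1 + x/2) * (exp (- a * x) - exp (- x)) \<le> (1 + x/2) * ((1 - a * x + (a * x)^2/2) - (1 - x + x^2/2 - x^3/6))"
    using assms by (intro mult_left_mono) auto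
  also have "\<dots> = (1 - a) * x - x^2 * (a * (1 - a) / 2 - x * a^2 / 4 + (x - x^2) / 12)"
    by (simp add: field_simps eval_nat_numeral)
  also have "\<dots> \<le> (1 - a) * x"
  proof -
    have "a * (1 - a) \<ge> 0.36787 * (1 - 0.36788)" using a by (intro mult_mono) auto
    moreover have "x * a^2 \<le> 1 * 0.36788^2" using a assms by (intro mult_mono power_mono) auto
    moreover have "x^2 \<le> x" using assms by (simp add: power2_eq_square mult_left_le)
    ultimately have "a * (1 - a) / 2 - x * a^2 / 4 + (x - x^2) / 12 \<ge> 0" by (simp add: power_divide)
    thus ?thesis by simp
  qed
  finally have "(1 + x/2) * (exp (- a * x) - exp (- x)) \<le> (1 - a) * x" .
  hence "q0 * ((1 + x/2) * (exp (- a * x) - exp (- x))) \<le> q0 * ((1 - a) * x)"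
    using q0_bounds by (intro mult_left_mono) auto
  also have "\<dots> = (exp (- a) - a) * x" using a by (simp add: q0_def a_def)
  finally show ?thesis using pos by (simp add: a_def field_simps)
qed

text \<open>The value for infinitesimal edges of total weight \<open>1\<close>. There a lone active
  edge is always red, so \<open>R2\<close> counts only when at least two edges are active;
  \<open>1 - 2 * inv_e\<close> is the Poisson probability of this event.\<close>

lemma ratio_ge_509: "1 - exp (- inv_e) + Q0 * (1 - 2 * inv_e) \<ge> 0.509"
proof -
  have "Q0 - (2*0.5127 - 0.5127^2) = (q0 - 0.5127) * (2 - q0 - 0.5127)"
    by (simp add: Q0_def algebra_simps power2_eq_square)
  also have "\<dots> \<ge> 0" using q0_bounds by (intro mult_nonneg_nonneg) auto
  finally have "Q0 \<ge> 0.7625" by (simp add: power2_eq_square)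
  hence "Q0 * (1 - 2*inv_e) \<ge> 0.7625 * (1 - 2 * 0.36788)"
    using inv_e_bounds by (intro mult_mono) auto
  thus ?thesis using exp_inv_e_bounds by simp
qed

text \<open>The left-hand side is the bound on the contribution of \<open>R2\<close> for
  infinitesimal edges of total weight \<open>t\<close>. It is concave in \<open>t\<close>, so it
  lies above its chord from \<open>t = 0\<close> to \<open>t = 1\<close>.\<close>

lemma infinitesimal_hit_lower:
  fixes t :: real
  assumes "0 \<le> t" "t \<le> 1"
  shows "Q0 * (1 - exp (- t) - t * exp (- t)) + q0 * t * (exp (- t) - inv_e) \<ge> Q0 * (1 - 2 * inv_e) * t"
proof -
  define f where "f = (\<lambda>t. Q0 * (1 - exp (- t) - t * exp (- t)) + q0 * t * (exp (- t) - inv_e))"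
  \<comment> \<open>These are \<open>q0^2\<close> and \<open>q0 * (1 - q0)\<close>; they are the
    coefficients in the second derivative of \<open>f\<close>.\<close>
  have QQ: "2 * q0 - Q0 \<ge> 0" "Q0 - q0 \<ge> 0"
    using q0_bounds mult_mono[of q0 1 q0 1] by (auto simp: Q0_def power2_eq_square)
  have "concave_on {0..1} f"
  proof (rule f''_le0_imp_concave)
    show "DERIV f t :> Q0 * (t * exp (- t)) + q0 * (exp (- t) - inv_e - t * exp (- t))" for t
      unfolding f_def by (auto intro!: derivative_eq_intros simp: algebra_simps)
    show "DERIV (\<lambda>t. Q0 * (t * exp (- t)) + q0 * (exp (- t) - inv_e - t * exp (- t))) t
        :> - (exp (- t) * ((2 * q0 - Q0) + t * (Q0 - q0)))" for t
      by (auto intro!: derivative_eq_intros simp: algebra_simps)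
    show "- (exp (- t) * ((2 * q0 - Q0) + t * (Q0 - q0))) \<le> 0" if "t \<in> {0..1}" for t
      using that QQ by simp
  qed auto
  hence "f ((1 - t) *\<^sub>R 0 + t *\<^sub>R 1) \<ge> (1 - t) * f 0 + t * f 1"
    using assms by (intro concave_onD) auto
  moreover have "f 0 = 0" "f 1 = Q0 * (1 - 2 * inv_e)"
    by (auto simp: f_def inv_e_def)
  ultimately show ?thesis by (simp add: f_def mult.commute)
qed

text \<open>The part beyond the infinitesimal bound splits into one excess per edge, nonnegative by
  \<open>edge_excess_nonneg\<close>. What remains depends on \<open>t\<close> alone and is settled
  by concavity and the numerical constant.\<close>

lemma hit_bound:
  fixes x :: "'i \<Rightarrow> real"
  assumes "finite T" "\<And>e. e \<in> T \<Longrightarrow> 0 \<le> x e" "sum x T \<le> 1"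
  defines "t \<equiv> sum x T"
  shows "(1 - exp (- inv_e)) * t + Q0 * (1 - exp (- t) - exp (- t) * (\<Sum>e\<in>T. exp (x e) - 1))
     + (\<Sum>e\<in>T. q0 * (1 + x e / 2) * (exp (- t) * (exp (x e) - 1) - (1 - exp (- inv_e * x e))))
     + k0 * exp (- t) * (\<Sum>e\<in>T. x e * (exp (x e) - 1) * (\<Sum>e'\<in>T - {e}. exp (x e') - 1)) \<ge> 0.509 * t"
proof -
  define y where "y = exp (- t)"
  have t: "0 \<le> t" "t \<le> 1" using assms by (auto intro: sum_nonneg)
  have xt: "x e \<le> t" if "e \<in> T" for e
    unfolding t_def using assms that by (intro member_le_sum) auto
  have k0: "k0 \<ge> 0" using k0_bounds by simp
  have kQ: "4 * k0 = Q0 - q0" by (simp add: k0_def Q0_def field_simps power2_eq_square)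
  \<comment> \<open>Interactions with other edges are bounded through \<open>t - x e\<close>, using
    that \<open>exp z - 1\<close> is at least \<open>z\<close>, so that each summand involves only
    \<open>x e\<close> and \<open>t\<close>.\<close>
  have pair: "x e * (exp (x e) - 1) * (\<Sum>e'\<in>T - {e}. exp (x e') - 1) \<ge> x e ^ 2 * (t - x e)" if e: "e \<in> T" for e
  proof -
    have "t - x e = (\<Sum>e'\<in>T - {e}. x e')" using assms e by (simp add: sum_diff1)
    also have "\<dots> \<le> (\<Sum>e'\<in>T - {e}. exp (x e') - 1)"
      by (intro sum_mono) (use exp_ge_add_one_self in \<open>simp add: algebra_simps\<close>)
    finally have "t - x e \<le> (\<Sum>e'\<in>T - {e}. exp (x e') - 1)" .
    moreover have "x e \<le> exp (x e) - 1" using exp_ge_add_one_self[of "x e"] by linarith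
    hence "x e * x e \<le> x e * (exp (x e) - 1)"
      using assms(2)[OF e] by (intro mult_left_mono)
    ultimately show ?thesis unfolding power2_eq_square using assms(2)[OF e] xt[OF e] \<open>x e \<le> exp (x e) - 1\<close>
      by (intro mult_mono[where a = "x e * x e"]) auto
  qed
  have "0 \<le> (\<Sum>e\<in>T. y * (q0 * x e / 2 * (exp (x e) - 1) - 4 * k0 * (exp (x e) - 1 - x e))
          - q0 * (1 + x e / 2) * (1 - exp (- inv_e * x e)) + q0 * inv_e * x e + y * (k0 * (x e)^2 * (t - x e)))"
    unfolding y_def using assms t xt by (intro sum_nonneg edge_excess_nonneg) auto
  also have "\<dots> \<le> (\<Sum>e\<in>T. y * (q0 * x e / 2 * (exp (x e) - 1) - (Q0 - q0) * (exp (x e) - 1 - x e))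
          - q0 * (1 + x e / 2) * (1 - exp (- inv_e * x e)) + q0 * inv_e * x e
          + y * (k0 * (x e * (exp (x e) - 1) * (\<Sum>e'\<in>T - {e}. exp (x e') - 1))))"
  proof (intro sum_mono add_mono order.refl)
    show "y * (q0 * x e / 2 * (exp (x e) - 1) - 4 * k0 * (exp (x e) - 1 - x e)) - q0 * (1 + x e / 2) * (1 - exp (- inv_e * x e))
       \<le> y * (q0 * x e / 2 * (exp (x e) - 1) - (Q0 - q0) * (exp (x e) - 1 - x e)) - q0 * (1 + x e / 2) * (1 - exp (- inv_e * x e))" for e
      by (simp add: kQ)
    show "y * (k0 * (x e)^2 * (t - x e)) \<le> y * (k0 * (x e * (exp (x e) - 1) * (\<Sum>e'\<in>T - {e}. exp (x e') - 1)))" if "e \<in> T" for e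
      using mult_left_mono[OF pair[OF that] k0] by (auto simp: y_def mult.assoc intro!: mult_left_mono)
  qed
  also have "\<dots> = (\<Sum>e\<in>T. (q0 * (1 + x e / 2) * (y * (exp (x e) - 1) - (1 - exp (- inv_e * x e))))
       + (- (Q0 * y)) * (exp (x e) - 1)
       + k0 * y * (x e * (exp (x e) - 1) * (\<Sum>e'\<in>T - {e}. exp (x e') - 1))
       + (Q0 * y - q0 * y + q0 * inv_e) * x e)"
    by (intro sum.cong refl) (simp add: field_simps)
  also have "\<dots> = (\<Sum>e\<in>T. q0 * (1 + x e / 2) * (y * (exp (x e) - 1) - (1 - exp (- inv_e * x e))))
     - Q0 * y * (\<Sum>e\<in>T. exp (x e) - 1)
     + k0 * y * (\<Sum>e\<in>T. x e * (exp (x e) - 1) * (\<Sum>e'\<in>T - {e}. exp (x e') - 1))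
     + (Q0 * y - q0 * y + q0 * inv_e) * t"
    unfolding sum.distrib t_def by (simp only: sum_distrib_left[symmetric]) simp
  finally have "0 \<le> \<dots>" .
  moreover have "Q0 * (1 - y - t * y) + q0 * t * (y - inv_e) \<ge> Q0 * (1 - 2 * inv_e) * t"
    unfolding y_def by (rule infinitesimal_hit_lower) (use t in auto)
  moreover have "(1 - exp (- inv_e) + Q0 * (1 - 2 * inv_e)) * t \<ge> 0.509 * t"
    using ratio_ge_509 t by (intro mult_right_mono) auto
  ultimately show ?thesis unfolding y_def[symmetric] by (simp add: algebra_simps)
qed

section \<open>Random subsets and product laws\<close>

lemma prob_bind_pmf:
  "measure_pmf.prob (bind_pmf M f) S = measure_pmf.expectation M (\<lambda>x. measure_pmf.prob (f x) S)"
proof -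
  have *: "measure_pmf.prob N S = pmf (map_pmf (\<lambda>x. x \<in> S) N) True" for N
    by (simp add: pmf_map vimage_def)
  show ?thesis unfolding * map_bind_pmf pmf_bind ..
qed

lemma expectation_bind_pmf_finite:
  fixes h :: "'b \<Rightarrow> real"
  assumes "finite (set_pmf p)" "\<And>x. x \<in> set_pmf p \<Longrightarrow> finite (set_pmf (f x))"
  shows "measure_pmf.expectation (bind_pmf p f) h = measure_pmf.expectation p (\<lambda>x. measure_pmf.expectation (f x) h)"
  using assms by (subst pmf_expectation_bind[of "set_pmf p"])
    (auto simp: integral_measure_pmf[of "set_pmf p"])

lemma expectation_cong_pmf:
  fixes f :: "'a \<Rightarrow> real"
  assumes "\<And>x. x \<in> set_pmf p \<Longrightarrow> f x = g x"
  shows "measure_pmf.expectation p f = measure_pmf.expectation p g"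
  using assms by (intro integral_cong_AE) (auto simp: AE_measure_pmf_iff)

lemma expectation_mono_pmf:
  fixes f :: "'a \<Rightarrow> real"
  assumes "finite (set_pmf p)" "\<And>x. x \<in> set_pmf p \<Longrightarrow> f x \<le> g x"
  shows "measure_pmf.expectation p f \<le> measure_pmf.expectation p g"
  using assms by (intro integral_mono_AE integrable_measure_pmf_finite) (auto simp: AE_measure_pmf_iff)

lemma prob_cong_pmf:
  assumes "\<And>x. x \<in> set_pmf p \<Longrightarrow> x \<in> A \<longleftrightarrow> x \<in> B"
  shows "measure_pmf.prob p A = measure_pmf.prob p B"
  using assms by (intro measure_prob_cong_0) (auto simp: pmf_eq_0_set_pmf)

lemma expectation_of_bool_pmf:
  "measure_pmf.expectation p (\<lambda>x. of_bool (P x)) = measure_pmf.prob p {x. P x}"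
proof -
  have "(\<lambda>x. of_bool (P x) :: real) = indicator {x. P x}" by (auto simp: indicator_def)
  then show ?thesis by simp
qed

lemma finite_set_Pi_pmf:
  assumes "finite W" "\<And>w. w \<in> W \<Longrightarrow> finite (set_pmf (K w))"
  shows "finite (set_pmf (Pi_pmf W d K))"
  using assms by (subst set_Pi_pmf) (auto intro!: finite_PiE_dflt)

lemma set_Pi_pmfD:
  assumes "finite W" "h \<in> set_pmf (Pi_pmf W d K)" "w \<in> W"
  shows "h w \<in> set_pmf (K w)"
  using assms by (auto simp: set_Pi_pmf PiE_dflt_def)

section \<open>Thinning and independent unions of random subsets\<close>

lemma bernoulli_pmf_bind:
  assumes "0 \<le> p" "p \<le> 1" "0 \<le> q" "q \<le> 1"
  shows "bind_pmf (bernoulli_pmf p) (\<lambda>b. if b then bernoulli_pmf q else return_pmf False) = bernoulli_pmf (p * q)"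
proof (rule pmf_eqI)
  fix b
  have pq: "0 \<le> p * q" "p * q \<le> 1" using assms by (auto intro: mult_le_one)
  show "pmf (bind_pmf (bernoulli_pmf p) (\<lambda>b. if b then bernoulli_pmf q else return_pmf False)) b = pmf (bernoulli_pmf (p * q)) b"
    using assms pq by (cases b) (auto simp: pmf_bind algebra_simps)
qed

lemma set_random_subset: "finite S \<Longrightarrow> X \<in> set_pmf (random_subset S p) \<Longrightarrow> X \<subseteq> S"
  by (auto simp: random_subset_def)

lemma prob_random_subset_Int:
  assumes "finite S" "T \<subseteq> S" "Y \<subseteq> T" and p: "\<And>e. e \<in> T \<Longrightarrow> 0 \<le> p e \<and> p e \<le> 1"
  shows "measure_pmf.prob (random_subset S p) {X. X \<inter> T = Y} = (\<Prod>e\<in>T. if e \<in> Y then p e else 1 - p e)"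
proof -
  \<comment> \<open>In terms of the independent coin flips the event is a product set, with no
    constraint outside \<open>T\<close>.\<close>
  define B where "B = (\<lambda>e. if e \<in> T then {e \<in> Y} else UNIV)"
  have "measure_pmf.prob (random_subset S p) {X. X \<inter> T = Y}
      = measure_pmf.prob (Pi_pmf S False (\<lambda>e. bernoulli_pmf (p e))) (Pi S B)"
    using assms(2,3) unfolding random_subset_def measure_map_pmf
    by (intro arg_cong[where f = "measure_pmf.prob _"]) (auto simp: B_def Pi_def vimage_def; blast)
  also have "\<dots> = (\<Prod>e\<in>S. measure_pmf.prob (bernoulli_pmf (p e)) (B e))"
    using assms(1) by (rule measure_Pi_pmf_Pi)
  also have "\<dots> = (\<Prod>e\<in>T. measure_pmf.prob (bernoulli_pmf (p e)) (B e))"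
    using assms(1,2) by (intro prod.mono_neutral_right) (auto simp: B_def)
  also have "\<dots> = (\<Prod>e\<in>T. if e \<in> Y then p e else 1 - p e)"
    using p by (intro prod.cong) (auto simp: B_def measure_pmf_single)
  finally show ?thesis .
qed

lemma prob_random_subset_superset:
  assumes "finite S" "Y \<subseteq> S" "\<And>e. e \<in> Y \<Longrightarrow> 0 \<le> p e \<and> p e \<le> 1"
  shows "measure_pmf.prob (random_subset S p) {X. Y \<subseteq> X} = prod p Y"
proof -
  have "{X. Y \<subseteq> X} = {X. X \<inter> Y = Y}" by auto
  then show ?thesis using prob_random_subset_Int[of S Y Y p] assms by simp
qed

lemma random_subset_thin:
  assumes S: "finite S" and p: "\<And>e. e \<in> S \<Longrightarrow> 0 \<le> p e \<and> p e \<le> 1" and q: "\<And>e. e \<in> S \<Longrightarrow> 0 \<le> q e \<and> q e \<le> 1"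
  shows "bind_pmf (random_subset S p) (\<lambda>R. random_subset R q) = random_subset S (\<lambda>e. p e * q e)"
proof -
  \<comment> \<open>The second draw is extended to all of \<open>S\<close>, with constant
    \<open>False\<close> off the first subset; both draws are then products over the same index set
    and compose coordinatewise.\<close>
  have 1: "random_subset {e \<in> S. b e} q =
     map_pmf (\<lambda>c. {e \<in> S. c e}) (Pi_pmf S False (\<lambda>e. if b e then bernoulli_pmf (q e) else return_pmf False))" for b
    unfolding random_subset_def Pi_pmf_if_set[OF S]
  proof (intro map_pmf_cong refl)
    fix c assume "c \<in> set_pmf (Pi_pmf {e \<in> S. b e} False (\<lambda>e. bernoulli_pmf (q e)))"
    moreover have "finite {e \<in> S. b e}" using S by simp
    ultimately have "\<forall>e. e \<notin> {e \<in> S. b e} \<longrightarrow> c e = False"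
      using set_Pi_pmf_subset[THEN subsetD] by fast
    then show "{e \<in> {e \<in> S. b e}. c e} = {e \<in> S. c e}" by blast
  qed
  have "bind_pmf (random_subset S p) (\<lambda>R. random_subset R q) =
     map_pmf (\<lambda>c. {e \<in> S. c e}) (bind_pmf (Pi_pmf S False (\<lambda>e. bernoulli_pmf (p e)))
        (\<lambda>b. Pi_pmf S False (\<lambda>e. if b e then bernoulli_pmf (q e) else return_pmf False)))"
    unfolding random_subset_def[of S p] bind_map_pmf 1 map_bind_pmf ..
  also have "bind_pmf (Pi_pmf S False (\<lambda>e. bernoulli_pmf (p e)))
        (\<lambda>b. Pi_pmf S False (\<lambda>e. if b e then bernoulli_pmf (q e) else return_pmf False)) =
      Pi_pmf S False (\<lambda>e. bind_pmf (bernoulli_pmf (p e)) (\<lambda>b. if b then bernoulli_pmf (q e) else return_pmf False))"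
    using S by (subst Pi_pmf_bind[where d' = False]) auto
  also have "\<dots> = Pi_pmf S False (\<lambda>e. bernoulli_pmf (p e * q e))"
    using p q by (intro Pi_pmf_cong refl bernoulli_pmf_bind) auto
  finally show ?thesis unfolding random_subset_def .
qed

lemma random_subset_Un:
  assumes "finite A" "finite B" "A \<inter> B = {}"
  shows "random_subset (A \<union> B) p =
    do {X \<leftarrow> random_subset A p; Y \<leftarrow> random_subset B p; return_pmf (X \<union> Y)}"
proof -
  have "random_subset (A \<union> B) p =
     map_pmf (\<lambda>(f, g). {e \<in> A. f e} \<union> {e \<in> B. g e})
       (pair_pmf (Pi_pmf A False (\<lambda>e. bernoulli_pmf (p e))) (Pi_pmf B False (\<lambda>e. bernoulli_pmf (p e))))"
    unfolding random_subset_def Pi_pmf_union[OF assms] map_pmf_comp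
    by (intro map_pmf_cong refl) (use assms(3) in auto)
  then show ?thesis
    unfolding random_subset_def
    by (simp add: pair_pmf_def map_bind_pmf bind_map_pmf)
qed

lemma random_subset_UN:
  assumes "finite W" "\<And>w. w \<in> W \<Longrightarrow> finite (S w)" "\<And>v w. v \<in> W \<Longrightarrow> w \<in> W \<Longrightarrow> v \<noteq> w \<Longrightarrow> S v \<inter> S w = {}"
  shows "random_subset (\<Union>w\<in>W. S w) p = map_pmf (\<lambda>h. \<Union>w\<in>W. h w) (Pi_pmf W {} (\<lambda>w. random_subset (S w) p))"
  using assms
proof (induction W rule: finite_induct)
  case empty
  then show ?case by (simp add: random_subset_def)
next
  case (insert w W)
  have "random_subset (\<Union>v\<in>insert w W. S v) p =
     do {X \<leftarrow> random_subset (S w) p; Y \<leftarrow> random_subset (\<Union>v\<in>W. S v) p; return_pmf (X \<union> Y)}"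
    unfolding UN_insert using insert.prems insert.hyps by (intro random_subset_Un) auto
  also have "random_subset (\<Union>v\<in>W. S v) p = map_pmf (\<lambda>h. \<Union>v\<in>W. h v) (Pi_pmf W {} (\<lambda>v. random_subset (S v) p))"
    by (rule insert.IH) (use insert.prems in auto)
  also have "do {X \<leftarrow> random_subset (S w) p; Y \<leftarrow> \<dots>; return_pmf (X \<union> Y)} =
     map_pmf (\<lambda>h. \<Union>v\<in>insert w W. h v) (Pi_pmf (insert w W) {} (\<lambda>v. random_subset (S v) p))"
    unfolding Pi_pmf_insert'[OF insert.hyps] map_bind_pmf bind_map_pmf map_return_pmf
    by (intro bind_pmf_cong refl arg_cong[where f = return_pmf]) (use insert.hyps in auto)
  finally show ?case .
qed

text \<open>Tensorization, as in the proof of Harris' inequality: the one-coordinate hypothesis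
  applies with all other coordinates frozen, and averaging out that coordinate leaves antimonotone
  functions to which the induction hypothesis applies.\<close>

lemma negative_correlation_Pi_pmf:
  fixes K :: "'w \<Rightarrow> 'c pmf" and f g :: "('w \<Rightarrow> 'c) \<Rightarrow> real"
  assumes "finite W" and "\<And>w. w \<in> W \<Longrightarrow> finite (set_pmf (K w))"
    and refl: "\<And>k. le1 k k" "\<And>k. le2 k k"
    and "\<And>w \<phi> \<psi>. w \<in> W \<Longrightarrow> (\<And>k k'. le1 k k' \<Longrightarrow> \<phi> k' \<le> \<phi> k) \<Longrightarrow> (\<And>k k'. le2 k k' \<Longrightarrow> \<psi> k' \<le> \<psi> k) \<Longrightarrow>
      measure_pmf.expectation (K w) (\<lambda>k. \<phi> k * \<psi> k) \<le> measure_pmf.expectation (K w) \<phi> * measure_pmf.expectation (K w) (\<psi> :: 'c \<Rightarrow> real)"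
    and "\<And>h h'. (\<And>w. le1 (h w) (h' w)) \<Longrightarrow> f h' \<le> f h"
    and "\<And>h h'. (\<And>w. le2 (h w) (h' w)) \<Longrightarrow> g h' \<le> g h"
  shows "measure_pmf.expectation (Pi_pmf W d K) (\<lambda>h. f h * g h)
      \<le> measure_pmf.expectation (Pi_pmf W d K) f * measure_pmf.expectation (Pi_pmf W d K) g"
  using assms(1,2,5-7)
proof (induction W arbitrary: f g rule: finite_induct)
  case empty
  then show ?case by simp
next
  case (insert w W)
  let ?P = "Pi_pmf W d K"
  define F where "F = (\<lambda>(f :: ('w \<Rightarrow> 'c) \<Rightarrow> real) h. measure_pmf.expectation (K w) (\<lambda>y. f (h(w := y))))"
  have finP: "finite (set_pmf ?P)" using insert by (intro finite_set_Pi_pmf) auto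
  have finK: "finite (set_pmf (K w))" using insert by auto
  have split: "measure_pmf.expectation (Pi_pmf (insert w W) d K) f = measure_pmf.expectation ?P (F f)" for f :: "('w \<Rightarrow> 'c) \<Rightarrow> real"
  proof -
    have "Pi_pmf (insert w W) d K = bind_pmf ?P (\<lambda>h. map_pmf (\<lambda>y. h(w := y)) (K w))"
      unfolding Pi_pmf_insert'[OF insert.hyps] map_pmf_def by (rule bind_commute_pmf)
    moreover have "measure_pmf.expectation (bind_pmf ?P (\<lambda>h. map_pmf (\<lambda>y. h(w := y)) (K w))) f
        = measure_pmf.expectation ?P (\<lambda>h. measure_pmf.expectation (map_pmf (\<lambda>y. h(w := y)) (K w)) f)"
      using finP finK by (intro expectation_bind_pmf_finite) auto
    ultimately show ?thesis by (simp add: F_def)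
  qed
  \<comment> \<open>Reflexivity of the relation enters here, because both arguments receive the same
    value at \<open>w\<close>.\<close>
  have anti: "F \<phi> h' \<le> F \<phi> h" if "\<And>w. le (h w) (h' w)" "\<And>k. le k k"
    "\<And>h h'. (\<And>w. le (h w) (h' w)) \<Longrightarrow> \<phi> h' \<le> \<phi> h" for \<phi> :: "('w \<Rightarrow> 'c) \<Rightarrow> real" and h h' le
    unfolding F_def using finK that by (intro expectation_mono_pmf) auto
  have "F (\<lambda>h. f h * g h) h \<le> F f h * F g h" for h
    unfolding F_def by (rule insert.prems(2)) (use refl in \<open>auto intro!: insert.prems(3,4)\<close>)
  then have "measure_pmf.expectation ?P (F (\<lambda>h. f h * g h)) \<le> measure_pmf.expectation ?P (\<lambda>h. F f h * F g h)"
    using finP by (intro expectation_mono_pmf) auto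
  also have "\<dots> \<le> measure_pmf.expectation ?P (F f) * measure_pmf.expectation ?P (F g)"
  proof (rule insert.IH)
    show "F f h' \<le> F f h" if "\<And>v. le1 (h v) (h' v)" for h h'
      using that refl(1) insert.prems(3) by (rule anti)
    show "F g h' \<le> F g h" if "\<And>v. le2 (h v) (h' v)" for h h'
      using that refl(2) insert.prems(4) by (rule anti)
    show "measure_pmf.expectation (K v) (\<lambda>k. \<phi> k * \<psi> k) \<le> measure_pmf.expectation (K v) \<phi> * measure_pmf.expectation (K v) \<psi>"
      if "v \<in> W" "\<And>k k'. le1 k k' \<Longrightarrow> \<phi> k' \<le> \<phi> k" "\<And>k k'. le2 k k' \<Longrightarrow> \<psi> k' \<le> \<psi> k"
      for v and \<phi> \<psi> :: "'c \<Rightarrow> real"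
      using that by (intro insert.prems(2)) auto
    show "finite (set_pmf (K v))" if "v \<in> W" for v using that insert.prems(1) by auto
  qed
  finally show ?case unfolding split .
qed

section \<open>The colours at the vertices of V2\<close>

text \<open>The red and blue edges at one vertex \<open>w\<close>. Drawing \<open>R\<close> and then
  the active edges is merged into one draw, since \<open>x e\<close> times the conditional activity
  probability equals \<open>1 - exp (- x e)\<close>.\<close>

definition block ::
    "('a \<times> 'b) set \<Rightarrow> ('a \<times> 'b \<Rightarrow> real) \<Rightarrow> ('a \<times> 'b \<Rightarrow> real) \<Rightarrow> 'b \<Rightarrow>
     (('a \<times> 'b) set \<times> ('a \<times> 'b) set) pmf" where
  "block E x \<rho> w = do {
     A \<leftarrow> random_subset (edges_at2 E w) (\<lambda>e. 1 - exp (- x e));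
     D \<leftarrow> random_subset (lone_edges A) \<rho>;
     return_pmf (D, A - D)
   }"

lemma finite_edges_at2: "finite E \<Longrightarrow> finite (edges_at2 E w)"
  by (simp add: edges_at2_def)

lemma lone_edges_subset: "lone_edges A \<subseteq> A"
  by (auto simp: lone_edges_def)

lemma set_block:
  assumes E: "finite E" and k: "k \<in> set_pmf (block E x \<rho> w)"
  shows "fst k \<union> snd k \<subseteq> edges_at2 E w" "fst k \<inter> snd k = {}" "d \<in> fst k \<Longrightarrow> fst k \<union> snd k = {d}"
proof -
  obtain A D where A: "A \<in> set_pmf (random_subset (edges_at2 E w) (\<lambda>e. 1 - exp (- x e)))"
    and D: "D \<in> set_pmf (random_subset (lone_edges A) \<rho>)" and k: "k = (D, A - D)"
    using k by (auto simp: block_def)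
  have Aw: "A \<subseteq> edges_at2 E w" using A E by (intro set_random_subset finite_edges_at2)
  then have "finite A" using finite_edges_at2[OF E] by (rule finite_subset)
  then have "finite (lone_edges A)" by (rule finite_subset[OF lone_edges_subset])
  then have Dl: "D \<subseteq> lone_edges A" using D by (rule set_random_subset)
  then have "D \<subseteq> A" using lone_edges_subset by blast
  then show "fst k \<union> snd k \<subseteq> edges_at2 E w" "fst k \<inter> snd k = {}" using Aw k by auto
  assume "d \<in> fst k"
  then have d: "d \<in> D" "d \<in> lone_edges A" "d \<in> A" using k Dl \<open>D \<subseteq> A\<close> by auto
  have "edges_at2 A (snd d) = A" using Aw d(3) by (auto simp: edges_at2_def)
  then have "A = {d}" using d(2) by (simp add: lone_edges_def)
  then show "fst k \<union> snd k = {d}" using d \<open>D \<subseteq> A\<close> k by auto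
qed

lemma finite_set_block:
  assumes "finite E" shows "finite (set_pmf (block E x \<rho> w))"
proof (rule finite_subset)
  show "set_pmf (block E x \<rho> w) \<subseteq> Pow (edges_at2 E w) \<times> Pow (edges_at2 E w)"
    using set_block(1)[OF assms] by fastforce
  show "finite (Pow (edges_at2 E w) \<times> Pow (edges_at2 E w))"
    using finite_edges_at2[OF assms] by simp
qed

lemma map_union_block:
  assumes "finite E"
  shows "map_pmf (\<lambda>k. fst k \<union> snd k) (block E x \<rho> w) = random_subset (edges_at2 E w) (\<lambda>e. 1 - exp (- x e))"
proof -
  have "map_pmf (\<lambda>k. fst k \<union> snd k) (block E x \<rho> w) =
     do {A \<leftarrow> random_subset (edges_at2 E w) (\<lambda>e. 1 - exp (- x e));
         D \<leftarrow> random_subset (lone_edges A) \<rho>; return_pmf (D \<union> (A - D))}"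
    by (simp add: block_def map_bind_pmf)
  also have "\<dots> = do {A \<leftarrow> random_subset (edges_at2 E w) (\<lambda>e. 1 - exp (- x e));
         D \<leftarrow> random_subset (lone_edges A) \<rho>; return_pmf A}"
  proof (intro bind_pmf_cong refl arg_cong[where f = return_pmf])
    fix A D assume A: "A \<in> set_pmf (random_subset (edges_at2 E w) (\<lambda>e. 1 - exp (- x e)))"
      and D: "D \<in> set_pmf (random_subset (lone_edges A) \<rho>)"
    have "A \<subseteq> edges_at2 E w" using finite_edges_at2[OF assms] A by (rule set_random_subset)
    then have "finite A" using finite_edges_at2[OF assms] by (rule finite_subset)
    then have "finite (lone_edges A)" by (rule finite_subset[OF lone_edges_subset])
    then have "D \<subseteq> A" using D lone_edges_subset set_random_subset by (metis order_trans)
    then show "D \<union> (A - D) = A" by auto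
  qed
  finally show ?thesis by (simp add: bind_return_pmf')
qed

text \<open>Edges at different vertices of \<open>V2\<close> are disjoint, and whether an active
  edge is lone is decided by the edges at its own vertex, so the colouring consists of independent
  blocks.\<close>

lemma colouring_red_blue:
  assumes E: "finite E" "E \<subseteq> V1 \<times> V2" "finite V2" and x: "\<And>e. e \<in> E \<Longrightarrow> 0 < x e \<and> x e \<le> 1"
  shows "map_pmf (\<lambda>(D, B, Y). (D, B)) (colouring E x \<rho>) =
     map_pmf (\<lambda>h. (\<Union>w\<in>V2. fst (h w), \<Union>w\<in>V2. snd (h w))) (Pi_pmf V2 ({}, {}) (block E x \<rho>))"
proof -
  let ?p = "\<lambda>e. 1 - exp (- x e)" and ?q = "\<lambda>e. (1 - exp (- x e)) / x e"
  let ?R = "\<lambda>A. do {D \<leftarrow> random_subset (lone_edges A) \<rho>; return_pmf (D, A - D)}"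
  have q: "0 \<le> ?q e \<and> ?q e \<le> 1" if "e \<in> E" for e
    using x[OF that] exp_ge_add_one_self[of "- x e"] by (auto simp: divide_le_eq algebra_simps)
  have "random_subset E (\<lambda>e. x e * ?q e) = random_subset E ?p"
    unfolding random_subset_def using x by (intro map_pmf_cong Pi_pmf_cong arg_cong[where f = bernoulli_pmf] refl) force
  then have thin: "bind_pmf (random_subset E x) (\<lambda>R. random_subset R ?q) = random_subset E ?p"
    using random_subset_thin[of E x ?q] E(1) x q by (metis less_imp_le)
  have "map_pmf (\<lambda>(D, B, Y). (D, B)) (colouring E x \<rho>) =
      bind_pmf (random_subset E x) (\<lambda>R. bind_pmf (random_subset R ?q) ?R)"
    by (simp add: colouring_def map_bind_pmf)
  also have "\<dots> = bind_pmf (random_subset E ?p) ?R"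
    by (simp only: thin[symmetric] bind_assoc_pmf)
  also have "random_subset E ?p = random_subset (\<Union>w\<in>V2. edges_at2 E w) ?p"
    by (rule arg_cong[where f = "\<lambda>S. random_subset S ?p"]) (use E in \<open>auto simp: edges_at2_def\<close>)
  also have "\<dots> = map_pmf (\<lambda>h. \<Union>w\<in>V2. h w) (Pi_pmf V2 {} (\<lambda>w. random_subset (edges_at2 E w) ?p))"
    using E by (intro random_subset_UN) (auto simp: edges_at2_def)
  also have "bind_pmf \<dots> ?R = do {h \<leftarrow> Pi_pmf V2 {} (\<lambda>w. random_subset (edges_at2 E w) ?p); ?R (\<Union>w\<in>V2. h w)}"
    by (rule bind_map_pmf)
  also have "\<dots> = do {h \<leftarrow> Pi_pmf V2 {} (\<lambda>w. random_subset (edges_at2 E w) ?p);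
       d \<leftarrow> Pi_pmf V2 {} (\<lambda>w. random_subset (lone_edges (h w)) \<rho>);
       return_pmf (\<Union>w\<in>V2. d w, \<Union>w\<in>V2. h w - d w)}"
  proof (rule bind_pmf_cong[OF refl])
    fix h assume h: "h \<in> set_pmf (Pi_pmf V2 {} (\<lambda>w. random_subset (edges_at2 E w) ?p))"
    have hE: "h w \<subseteq> edges_at2 E w" if "w \<in> V2" for w
      using set_Pi_pmfD[OF E(3) h that] finite_edges_at2[OF E(1)] by (metis set_random_subset)
    have disj: "h v \<inter> h w = {}" if "v \<in> V2" "w \<in> V2" "v \<noteq> w" for v w
      using hE[OF that(1)] hE[OF that(2)] that(3) by (auto simp: edges_at2_def)
    have fin: "finite (h w)" if "w \<in> V2" for w
      using hE[OF that] finite_edges_at2[OF E(1)] by (rule finite_subset)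
    have at: "edges_at2 (\<Union>w\<in>V2. h w) v = h v" if "v \<in> V2" for v
      using hE that by (fastforce simp: edges_at2_def)
    have at': "edges_at2 (h v) v = h v" if "v \<in> V2" for v
      using hE that by (fastforce simp: edges_at2_def)
    have sn: "snd e = w" if "w \<in> V2" "e \<in> h w" for e w
      using hE[OF that(1)] that(2) by (auto simp: edges_at2_def)
    \<comment> \<open>Adding edges at other vertices of \<open>V2\<close> does not change which
      edges of \<open>h w\<close> are lone.\<close>
    have lone: "lone_edges (\<Union>w\<in>V2. h w) = (\<Union>w\<in>V2. lone_edges (h w))"
    proof -
      have "edges_at2 (\<Union>w\<in>V2. h w) (snd e) = edges_at2 (h w) (snd e)" if "w \<in> V2" "e \<in> h w" for e w
        using at[OF that(1)] at'[OF that(1)] sn[OF that] by simp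
      then show ?thesis unfolding lone_edges_def by blast
    qed
    have "random_subset (\<Union>w\<in>V2. lone_edges (h w)) \<rho> =
        map_pmf (\<lambda>d. \<Union>w\<in>V2. d w) (Pi_pmf V2 {} (\<lambda>w. random_subset (lone_edges (h w)) \<rho>))"
    proof (rule random_subset_UN[OF E(3)])
      show "finite (lone_edges (h w))" if "w \<in> V2" for w
        using fin[OF that] by (rule finite_subset[OF lone_edges_subset])
      show "lone_edges (h v) \<inter> lone_edges (h w) = {}" if "v \<in> V2" "w \<in> V2" "v \<noteq> w" for v w
        using disj[OF that] lone_edges_subset[of "h v"] lone_edges_subset[of "h w"] by blast
    qed
    then have "?R (\<Union>w\<in>V2. h w) = do {d \<leftarrow> Pi_pmf V2 {} (\<lambda>w. random_subset (lone_edges (h w)) \<rho>);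
        return_pmf (\<Union>w\<in>V2. d w, (\<Union>w\<in>V2. h w) - (\<Union>w\<in>V2. d w))}"
      by (simp add: lone bind_map_pmf)
    also have "\<dots> = do {d \<leftarrow> Pi_pmf V2 {} (\<lambda>w. random_subset (lone_edges (h w)) \<rho>);
        return_pmf (\<Union>w\<in>V2. d w, \<Union>w\<in>V2. h w - d w)}"
    proof (intro bind_pmf_cong refl arg_cong[where f = return_pmf])
      fix d assume d: "d \<in> set_pmf (Pi_pmf V2 {} (\<lambda>w. random_subset (lone_edges (h w)) \<rho>))"
      have "d w \<subseteq> h w" if w: "w \<in> V2" for w
      proof -
        have "d w \<in> set_pmf (random_subset (lone_edges (h w)) \<rho>)"
          using set_Pi_pmfD[OF E(3) d w] .
        moreover have "finite (lone_edges (h w))" using fin[OF w] by (rule finite_subset[OF lone_edges_subset])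
        ultimately show ?thesis using lone_edges_subset by (metis order_trans set_random_subset)
      qed
      then have "(\<Union>w\<in>V2. h w) - (\<Union>w\<in>V2. d w) = (\<Union>w\<in>V2. h w - d w)"
        using sn by blast
      then show "(\<Union>w\<in>V2. d w, (\<Union>w\<in>V2. h w) - (\<Union>w\<in>V2. d w)) = (\<Union>w\<in>V2. d w, \<Union>w\<in>V2. h w - d w)" by simp
    qed
    finally show "?R (\<Union>w\<in>V2. h w) = \<dots>" .
  qed
  also have "\<dots> = map_pmf (\<lambda>h. (\<Union>w\<in>V2. fst (h w), \<Union>w\<in>V2. snd (h w))) (Pi_pmf V2 ({}, {}) (block E x \<rho>))"
    unfolding block_def using E(3)
    by (simp add: Pi_pmf_bind[where d' = "{}"] map_bind_pmf)
  finally show ?thesis .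
qed

text \<open>The case with value \<open>0\<close> covers pairs that are not edges, so that the
  covariance computation can treat any pair \<open>(u, w)\<close> uniformly.\<close>

lemma prob_block_superset:
  assumes E: "finite E" and x: "\<And>e. e \<in> E \<Longrightarrow> 0 < x e \<and> x e \<le> 1"
  shows "measure_pmf.prob (block E x \<rho> w) {k. Y \<subseteq> fst k \<union> snd k} =
     (if Y \<subseteq> edges_at2 E w then \<Prod>e\<in>Y. 1 - exp (- x e) else 0)"
proof -
  have "measure_pmf.prob (block E x \<rho> w) {k. Y \<subseteq> fst k \<union> snd k} =
     measure_pmf.prob (random_subset (edges_at2 E w) (\<lambda>e. 1 - exp (- x e))) {X. Y \<subseteq> X}"
    by (subst map_union_block[OF E, where \<rho> = \<rho>, symmetric]) (simp add: vimage_def)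
  also have "\<dots> = (if Y \<subseteq> edges_at2 E w then \<Prod>e\<in>Y. 1 - exp (- x e) else 0)"
  proof (cases "Y \<subseteq> edges_at2 E w")
    case True
    then have "0 \<le> x e" if "e \<in> Y" for e
      using x[of e] that by (auto simp: edges_at2_def)
    with True E show ?thesis by (simp add: prob_random_subset_superset finite_edges_at2)
  next
    case False
    then have "set_pmf (random_subset (edges_at2 E w) (\<lambda>e. 1 - exp (- x e))) \<inter> {X. Y \<subseteq> X} = {}"
      using set_random_subset[OF finite_edges_at2[OF E]] by (metis (no_types, lifting) disjoint_iff mem_Collect_eq order_trans)
    with False show ?thesis by (simp add: measure_pmf_zero_iff)
  qed
  finally show ?thesis .
qed

text \<open>The order uncoloured, blue, red for edges at \<open>u\<close>: moving up enlarges the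
  red set and the active set, while the blue set may shrink. Edges at other vertices of
  \<open>V1\<close> are ignored.\<close>

definition colour_le :: "'a \<Rightarrow> ('a \<times> 'b) set \<times> ('a \<times> 'b) set \<Rightarrow> ('a \<times> 'b) set \<times> ('a \<times> 'b) set \<Rightarrow> bool" where
  "colour_le u k k' \<longleftrightarrow> edges_at1 (fst k) u \<subseteq> edges_at1 (fst k') u \<and>
     edges_at1 (fst k \<union> snd k) u \<subseteq> edges_at1 (fst k' \<union> snd k') u"

text \<open>In the block of \<open>w\<close> only the edge \<open>(u, w)\<close> is visible from
  \<open>u\<close>. Hence \<open>\<phi>\<close> takes one value for each of three colours and is
  affine in the indicators of being active and of being red.\<close>

lemma colour_antimono_affine:
  assumes E: "finite E" and k: "k \<in> set_pmf (block E x \<rho> w)"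
    and \<phi>: "\<And>k k'. colour_le u k k' \<Longrightarrow> \<phi> k' \<le> (\<phi> k :: real)"
  shows "\<phi> k = \<phi> ({}, {}) - (\<phi> ({}, {}) - \<phi> ({}, {(u, w)})) * of_bool ((u, w) \<in> fst k \<union> snd k)
     - (\<phi> ({}, {(u, w)}) - \<phi> ({(u, w)}, {})) * of_bool ((u, w) \<in> fst k)"
proof -
  have eq: "\<phi> k = \<phi> k'" if "colour_le u k k'" "colour_le u k' k" for k k'
    using \<phi>[OF that(1)] \<phi>[OF that(2)] by simp
  have sub: "fst k \<subseteq> UNIV \<times> {w}" "snd k \<subseteq> UNIV \<times> {w}" "fst k \<inter> snd k = {}"
    using set_block(1,2)[OF E k] by (auto simp: edges_at2_def)
  consider "(u, w) \<in> fst k" "(u, w) \<notin> snd k" | "(u, w) \<notin> fst k" "(u, w) \<in> snd k" | "(u, w) \<notin> fst k" "(u, w) \<notin> snd k"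
    using sub by auto
  then show ?thesis
  proof cases
    case 1
    have "\<phi> k = \<phi> ({(u, w)}, {})" using 1 sub by (intro eq) (auto simp: colour_le_def edges_at1_def)
    with 1 show ?thesis by simp
  next
    case 2
    have "\<phi> k = \<phi> ({}, {(u, w)})" using 2 sub by (intro eq) (auto simp: colour_le_def edges_at1_def)
    with 2 show ?thesis by simp
  next
    case 3
    have "\<phi> k = \<phi> ({}, {})" using 3 sub by (intro eq) (auto simp: colour_le_def edges_at1_def)
    with 3 show ?thesis by simp
  qed
qed

text \<open>Activity of the two edges is independent, whereas a red edge excludes every other active edge
  at the same vertex of \<open>V2\<close>; only the latter effect contributes to the covariance.\<close>
lemma negative_correlation_block:
  fixes \<phi> \<psi> :: "('a \<times> 'b) set \<times> ('a \<times> 'b) set \<Rightarrow> real" and \<rho> :: "'a \<times> 'b \<Rightarrow> real" and w :: 'b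
  assumes E: "finite E" and x: "\<And>e. e \<in> E \<Longrightarrow> 0 < x e \<and> x e \<le> 1" and "u \<noteq> u'"
    and \<phi>: "\<And>k k'. colour_le u k k' \<Longrightarrow> \<phi> k' \<le> \<phi> k" and \<psi>: "\<And>k k'. colour_le u' k k' \<Longrightarrow> \<psi> k' \<le> \<psi> k"
  defines "M \<equiv> measure_pmf (block E x \<rho> w)"
  shows "(\<integral>k. \<phi> k * \<psi> k \<partial>M) \<le> (\<integral>k. \<phi> k \<partial>M) * (\<integral>k. \<psi> k \<partial>M)"
proof -
  define a where "a = (\<lambda>u (k :: ('a \<times> 'b) set \<times> ('a \<times> 'b) set). of_bool ((u, w) \<in> fst k \<union> snd k) :: real)"
  define r where "r = (\<lambda>u (k :: ('a \<times> 'b) set \<times> ('a \<times> 'b) set). of_bool ((u, w) \<in> fst k) :: real)"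
  define c where "c = \<phi> ({}, {})"
  define \<alpha> where "\<alpha> = \<phi> ({}, {}) - \<phi> ({}, {(u, w)})"
  define \<beta> where "\<beta> = \<phi> ({}, {(u, w)}) - \<phi> ({(u, w)}, {})"
  define c' where "c' = \<psi> ({}, {})"
  define \<alpha>' where "\<alpha>' = \<psi> ({}, {}) - \<psi> ({}, {(u', w)})"
  define \<beta>' where "\<beta>' = \<psi> ({}, {(u', w)}) - \<psi> ({(u', w)}, {})"
  \<comment> \<open>Each coefficient is the drop of an antimonotone function along one step from
    uncoloured to blue or from blue to red.\<close>
  have nn: "\<alpha> \<ge> 0" "\<beta> \<ge> 0" "\<alpha>' \<ge> 0" "\<beta>' \<ge> 0"
    unfolding \<alpha>_def \<beta>_def \<alpha>'_def \<beta>'_def diff_ge_0_iff_ge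
    by (auto intro!: \<phi> \<psi> simp: colour_le_def edges_at1_def)
  have int: "integrable M f" for f :: "_ \<Rightarrow> real"
    unfolding M_def by (intro integrable_measure_pmf_finite finite_set_block E)
  have \<phi>': "\<phi> k = c - \<alpha> * a u k - \<beta> * r u k" and \<psi>': "\<psi> k = c' - \<alpha>' * a u' k - \<beta>' * r u' k"
    if "k \<in> set_pmf (block E x \<rho> w)" for k
    unfolding c_def \<alpha>_def \<beta>_def c'_def \<alpha>'_def \<beta>'_def a_def r_def
    by (rule colour_antimono_affine[OF E that], rule \<phi>, assumption)
      (rule colour_antimono_affine[OF E that], rule \<psi>, assumption)
  \<comment> \<open>All mixed products containing a red indicator vanish, since a red edge is the
    only active one in its block.\<close>
  have prod: "\<phi> k * \<psi> k = c * c' - c * \<alpha>' * a u' k - c * \<beta>' * r u' k - c' * \<alpha> * a u k - c' * \<beta> * r u k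
      + \<alpha> * \<alpha>' * of_bool ({(u, w), (u', w)} \<subseteq> fst k \<union> snd k)"
    if "k \<in> set_pmf (block E x \<rho> w)" for k
  proof -
    have "r u k * a u' k = 0" "a u k * r u' k = 0" "r u k * r u' k = 0"
      using set_block(3)[OF E that, of "(u, w)"] set_block(3)[OF E that, of "(u', w)"] \<open>u \<noteq> u'\<close>
      by (auto simp: a_def r_def)
    moreover have "a u k * a u' k = of_bool ({(u, w), (u', w)} \<subseteq> fst k \<union> snd k)"
      by (simp add: a_def)
    ultimately show ?thesis unfolding \<phi>'[OF that] \<psi>'[OF that] by algebra
  qed
  have aa: "(\<integral>k. of_bool ({(u, w), (u', w)} \<subseteq> fst k \<union> snd k) \<partial>M) = (\<integral>k. a u k \<partial>M) * (\<integral>k. a u' k \<partial>M)"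
    using prob_block_superset[OF E x, where Y = "{(u, w), (u', w)}" and \<rho> = \<rho> and w = w]
      prob_block_superset[OF E x, where Y = "{(u, w)}" and \<rho> = \<rho> and w = w]
      prob_block_superset[OF E x, where Y = "{(u', w)}" and \<rho> = \<rho> and w = w] \<open>u \<noteq> u'\<close>
    unfolding M_def a_def expectation_of_bool_pmf by simp
  have r0: "(\<integral>k. r u k \<partial>M) \<ge> 0" "(\<integral>k. a u k \<partial>M) \<ge> 0" for u
    by (auto simp: r_def a_def)
  have "(\<integral>k. \<phi> k * \<psi> k \<partial>M) = (\<integral>k. c * c' - c * \<alpha>' * a u' k - c * \<beta>' * r u' k - c' * \<alpha> * a u k - c' * \<beta> * r u k
      + \<alpha> * \<alpha>' * of_bool ({(u, w), (u', w)} \<subseteq> fst k \<union> snd k) \<partial>M)"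
    unfolding M_def using prod by (intro expectation_cong_pmf)
  also have "\<dots> = c * c' - c * \<alpha>' * (\<integral>k. a u' k \<partial>M) - c * \<beta>' * (\<integral>k. r u' k \<partial>M) - c' * \<alpha> * (\<integral>k. a u k \<partial>M)
      - c' * \<beta> * (\<integral>k. r u k \<partial>M) + \<alpha> * \<alpha>' * ((\<integral>k. a u k \<partial>M) * (\<integral>k. a u' k \<partial>M))"
    unfolding aa[symmetric] by (simp add: int) (simp add: M_def)
  finally have 1: "(\<integral>k. \<phi> k * \<psi> k \<partial>M) = \<dots>" .
  have "(\<integral>k. \<phi> k \<partial>M) = (\<integral>k. c - \<alpha> * a u k - \<beta> * r u k \<partial>M)"
    unfolding M_def using \<phi>' by (intro expectation_cong_pmf)
  also have "\<dots> = c - \<alpha> * (\<integral>k. a u k \<partial>M) - \<beta> * (\<integral>k. r u k \<partial>M)"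
    by (simp add: int) (simp add: M_def)
  finally have 2: "(\<integral>k. \<phi> k \<partial>M) = \<dots>" .
  have "(\<integral>k. \<psi> k \<partial>M) = (\<integral>k. c' - \<alpha>' * a u' k - \<beta>' * r u' k \<partial>M)"
    unfolding M_def using \<psi>' by (intro expectation_cong_pmf)
  also have "\<dots> = c' - \<alpha>' * (\<integral>k. a u' k \<partial>M) - \<beta>' * (\<integral>k. r u' k \<partial>M)"
    by (simp add: int) (simp add: M_def)
  finally have 3: "(\<integral>k. \<psi> k \<partial>M) = \<dots>" .
  \<comment> \<open>The negative of the covariance is computed exactly: the active-active terms
    cancel, and those left are nonnegative.\<close>
  have "(\<integral>k. \<phi> k \<partial>M) * (\<integral>k. \<psi> k \<partial>M) - (\<integral>k. \<phi> k * \<psi> k \<partial>M) =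
      \<alpha> * \<beta>' * ((\<integral>k. a u k \<partial>M) * (\<integral>k. r u' k \<partial>M)) + \<beta> * \<alpha>' * ((\<integral>k. r u k \<partial>M) * (\<integral>k. a u' k \<partial>M))
      + \<beta> * \<beta>' * ((\<integral>k. r u k \<partial>M) * (\<integral>k. r u' k \<partial>M))"
    unfolding 1 2 3 by (simp add: algebra_simps)
  also have "\<dots> \<ge> 0" using nn r0 by simp
  finally show ?thesis by simp
qed

lemma negative_correlation_state:
  fixes f g :: "('b \<Rightarrow> ('a \<times> 'b) set \<times> ('a \<times> 'b) set) \<Rightarrow> real" and \<rho> :: "'a \<times> 'b \<Rightarrow> real" and W d
  assumes E: "finite E" and x: "\<And>e. e \<in> E \<Longrightarrow> 0 < x e \<and> x e \<le> 1" and "u \<noteq> u'" and "finite W"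
    and "\<And>h h'. (\<And>w. colour_le u (h w) (h' w)) \<Longrightarrow> f h' \<le> f h"
    and "\<And>h h'. (\<And>w. colour_le u' (h w) (h' w)) \<Longrightarrow> g h' \<le> g h"
  defines "M \<equiv> measure_pmf (Pi_pmf W d (block E x \<rho>))"
  shows "(\<integral>h. f h * g h \<partial>M) \<le> (\<integral>h. f h \<partial>M) * (\<integral>h. g h \<partial>M)"
  unfolding M_def
proof (rule negative_correlation_Pi_pmf[where ?le1.0 = "colour_le u" and ?le2.0 = "colour_le u'"])
  show "colour_le u k k" "colour_le u' k k" for k by (simp_all add: colour_le_def)
qed (use assms negative_correlation_block[OF E x \<open>u \<noteq> u'\<close>] finite_set_block[OF E] in auto)

section \<open>The blue selection\<close>

text \<open>The second component of \<open>select_at\<close>, which is the contribution of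
  \<open>u\<close> to \<open>R2\<close>.\<close>

definition blue_choice where
  "blue_choice \<sigma> D B u =
     (if edges_at1 D u \<noteq> {} then return_pmf {}
      else if edges_at1 B u \<noteq> {} then map_pmf (\<lambda>e. {e}) (\<sigma> u (edges_at1 B u))
      else return_pmf {})"

definition blue_selection where
  "blue_selection V1 \<sigma> D B = map_pmf (\<lambda>s. \<Union>u\<in>V1. s u) (Pi_pmf V1 {} (blue_choice \<sigma> D B))"

text \<open>The conditional probability that \<open>e\<close> enters \<open>R2\<close>, given all
  colours.\<close>

definition blue_prob where
  "blue_prob \<sigma> D B e =
     (if edges_at1 D (fst e) = {} \<and> e \<in> B then pmf (\<sigma> (fst e) (edges_at1 B (fst e))) e else 0)"

lemma set_blue_choice:
  assumes "selection_rule V1 E \<sigma>" "u \<in> V1" "B \<subseteq> E" "X \<in> set_pmf (blue_choice \<sigma> D B u)"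
  shows "X \<subseteq> edges_at1 B u"
proof -
  have "edges_at1 B u \<subseteq> edges_at1 E u" using assms(3) by (auto simp: edges_at1_def)
  then have "set_pmf (\<sigma> u (edges_at1 B u)) \<subseteq> edges_at1 B u" if "edges_at1 B u \<noteq> {}"
    using assms(1,2) that by (auto simp: selection_rule_def)
  with assms(4) show ?thesis by (auto simp: blue_choice_def split: if_splits)
qed

lemma prob_blue_choice:
  assumes "selection_rule V1 E \<sigma>" "fst e \<in> V1" "B \<subseteq> E"
  shows "measure_pmf.prob (blue_choice \<sigma> D B (fst e)) {X. e \<in> X} = blue_prob \<sigma> D B e"
proof (cases "e \<in> B")
  case True
  then have "e \<in> edges_at1 B (fst e)" by (simp add: edges_at1_def)
  moreover have "{e'. e = e'} = {e}" by auto
  ultimately show ?thesis using True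
    by (auto simp: blue_choice_def blue_prob_def vimage_def measure_pmf_single)
next
  case False
  then have "set_pmf (blue_choice \<sigma> D B (fst e)) \<inter> {X. e \<in> X} = {}"
    using set_blue_choice[OF assms] by (fastforce simp: edges_at1_def)
  with False show ?thesis by (simp add: blue_prob_def measure_pmf_zero_iff)
qed

lemma prob_blue_selection:
  assumes "selection_rule V1 E \<sigma>" "finite V1" "fst e \<in> V1" "B \<subseteq> E"
  shows "measure_pmf.prob (blue_selection V1 \<sigma> D B) {X. e \<in> X} = blue_prob \<sigma> D B e"
proof -
  let ?P = "Pi_pmf V1 {} (blue_choice \<sigma> D B)"
  have "measure_pmf.prob (blue_selection V1 \<sigma> D B) {X. e \<in> X} = measure_pmf.prob ?P {s. e \<in> (\<Union>u\<in>V1. s u)}"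
    by (simp add: blue_selection_def vimage_def)
  also have "\<dots> = measure_pmf.prob ?P {s. e \<in> s (fst e)}"
  proof (rule prob_cong_pmf)
    fix s assume s: "s \<in> set_pmf ?P"
    have "s u \<subseteq> edges_at1 B u" if "u \<in> V1" for u
      using set_blue_choice[OF assms(1) that assms(4)] set_Pi_pmfD[OF assms(2) s that] .
    then have "u = fst e" if "u \<in> V1" "e \<in> s u" for u
      using that by (auto simp: edges_at1_def)
    then show "s \<in> {s. e \<in> (\<Union>u\<in>V1. s u)} \<longleftrightarrow> s \<in> {s. e \<in> s (fst e)}" using assms(3) by auto
  qed
  also have "\<dots> = measure_pmf.prob (map_pmf (\<lambda>s. s (fst e)) ?P) {X. e \<in> X}"
    by (simp add: vimage_def)
  also have "\<dots> = blue_prob \<sigma> D B e"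
    using assms by (simp add: Pi_pmf_component prob_blue_choice)
  finally show ?thesis .
qed

text \<open>Given the colours, different vertices of \<open>V1\<close> choose independently, so the
  probabilities of missing \<open>e\<close> and \<open>e'\<close> multiply.\<close>

lemma prob_blue_selection_pair:
  assumes "selection_rule V1 E \<sigma>" "finite V1" "B \<subseteq> E"
    and e: "fst e \<in> V1" "fst e' \<in> V1" "fst e \<noteq> fst e'" and T: "e \<in> T" "e' \<in> T"
  shows "1 - (1 - blue_prob \<sigma> D B e) * (1 - blue_prob \<sigma> D B e')
     \<le> measure_pmf.prob (blue_selection V1 \<sigma> D B) {X. X \<inter> T \<noteq> {}}"
proof -
  let ?P = "Pi_pmf V1 {} (blue_choice \<sigma> D B)" and ?S = "blue_selection V1 \<sigma> D B"
  define N where "N = (\<lambda>u. if u = fst e then {X. e \<notin> X} else if u = fst e' then {X. e' \<notin> X} else UNIV)"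
  have miss: "measure_pmf.prob (blue_choice \<sigma> D B (fst f)) {X. f \<notin> X} = 1 - blue_prob \<sigma> D B f" if "fst f \<in> V1" for f
  proof -
    have "{X. f \<notin> X} = UNIV - {X. f \<in> X}" by auto
    then show ?thesis
      using measure_pmf.prob_compl[of "{X. f \<in> X}" "blue_choice \<sigma> D B (fst f)"]
      by (simp add: prob_blue_choice[OF assms(1) that assms(3)])
  qed
  have "measure_pmf.prob ?S {X. X \<inter> T = {}} \<le> measure_pmf.prob ?P (Pi V1 N)"
    unfolding blue_selection_def measure_map_pmf
  proof (intro measure_pmf.finite_measure_mono subsetI)
    fix s assume "s \<in> (\<lambda>s. \<Union>u\<in>V1. s u) -` {X. X \<inter> T = {}}"
    then have "f \<notin> s (fst f)" if "f \<in> T" "fst f \<in> V1" for f using that by blast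
    then show "s \<in> Pi V1 N" using e T by (auto simp: N_def)
  qed simp
  also have "\<dots> = (\<Prod>u\<in>V1. measure_pmf.prob (blue_choice \<sigma> D B u) (N u))"
    using assms(2) by (rule measure_Pi_pmf_Pi)
  also have "\<dots> = (\<Prod>u\<in>{fst e, fst e'}. measure_pmf.prob (blue_choice \<sigma> D B u) (N u))"
    using assms(2) e by (intro prod.mono_neutral_right) (auto simp: N_def)
  also have "\<dots> = (1 - blue_prob \<sigma> D B e) * (1 - blue_prob \<sigma> D B e')"
    using e by (simp add: N_def miss)
  finally have "measure_pmf.prob ?S {X. X \<inter> T = {}} \<le> \<dots>" .
  moreover have "{X. X \<inter> T = {}} = UNIV - {X. X \<inter> T \<noteq> {}}" by auto
  ultimately show ?thesis
    using measure_pmf.prob_compl[of "{X. X \<inter> T \<noteq> {}}" ?S] by simp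
qed

text \<open>Given that \<open>e\<close> is blue, the probability that it enters \<open>R2\<close>, as a function of the colours at the vertices
  other than \<open>snd e\<close>. Clipping to \<open>E\<close> makes it antimonotone even outside the support.\<close>
definition off_factor where
  "off_factor V2 E \<sigma> e h =
     (if edges_at1 (\<Union>w\<in>V2 - {snd e}. fst (h w)) (fst e) = {}
      then pmf (\<sigma> (fst e) (insert e (edges_at1 (E \<inter> (\<Union>w\<in>V2 - {snd e}. snd (h w))) (fst e)))) e else 0)"

lemma off_factor_bounds: "0 \<le> off_factor V2 E \<sigma> e h" "off_factor V2 E \<sigma> e h \<le> 1"
  by (auto simp: off_factor_def pmf_le_1)

text \<open>A red edge at \<open>fst e\<close> makes the factor vanish. If the higher state has
  none, active edges there are blue, so the blue set grows with the order and the monotone rule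
  selects \<open>e\<close> less often.\<close>

lemma off_factor_antimono:
  assumes "monotone_rule V1 E \<sigma>" "e \<in> E" "fst e \<in> V1"
    and le: "\<And>w. colour_le (fst e) (h w) (h' w)"
  shows "off_factor V2 E \<sigma> e h' \<le> off_factor V2 E \<sigma> e h"
proof -
  let ?u = "fst e" and ?W = "V2 - {snd e}"
  let ?D = "\<lambda>h. edges_at1 (\<Union>w\<in>?W. fst (h w)) ?u"
    and ?B = "\<lambda>h. insert e (edges_at1 (E \<inter> (\<Union>w\<in>?W. snd (h w))) ?u)"
  have le: "edges_at1 (fst (h w)) ?u \<subseteq> edges_at1 (fst (h' w)) ?u"
    "edges_at1 (fst (h w) \<union> snd (h w)) ?u \<subseteq> edges_at1 (fst (h' w) \<union> snd (h' w)) ?u" for w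
    using le[of w] by (auto simp: colour_le_def)
  show ?thesis
  proof (cases "?D h' = {}")
    case True
    have "?D h = {}" using True le(1) unfolding edges_at1_def by blast
    moreover have "?B h \<subseteq> ?B h'"
    proof
      fix f assume "f \<in> ?B h"
      then consider "f = e" | w where "w \<in> ?W" "f \<in> snd (h w)" "f \<in> E" "fst f = ?u"
        by (auto simp: edges_at1_def)
      then show "f \<in> ?B h'"
      proof cases
        case 2
        then have "f \<in> fst (h' w) \<union> snd (h' w)" using le(2)[of w] by (auto simp: edges_at1_def)
        moreover have "f \<notin> fst (h' w)" using True 2 unfolding edges_at1_def by blast
        ultimately show ?thesis using 2 by (auto simp: edges_at1_def)
      qed simp
    qed
    moreover have "?B h' \<subseteq> edges_at1 E ?u" using assms(2) by (auto simp: edges_at1_def)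
    moreover have "e \<in> ?B h" by simp
    ultimately have "e \<in> ?B h \<and> ?B h \<subseteq> ?B h' \<and> ?B h' \<subseteq> edges_at1 E ?u" by (intro conjI)
    then have "pmf (\<sigma> ?u (?B h')) e \<le> pmf (\<sigma> ?u (?B h)) e"
      by (rule assms(1)[unfolded monotone_rule_def, rule_format, OF assms(3)])
    with True \<open>?D h = {}\<close> show ?thesis by (simp add: off_factor_def)
  next
    case False
    then show ?thesis using off_factor_bounds(1) by (simp add: off_factor_def)
  qed
qed

text \<open>Separates the block of \<open>v\<close> from the independent blocks elsewhere, so that
  the two can be averaged one after the other.\<close>

lemma blue_prob_state:
  assumes E: "finite E" and V2: "finite V2" and e: "e \<in> E" "snd e = v" "v \<in> V2"
    and k: "k \<in> set_pmf (block E x \<rho> v)" and h: "h \<in> set_pmf (Pi_pmf (V2 - {v}) d (block E x \<rho>))"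
  defines "h' \<equiv> h(v := k)"
  shows "blue_prob \<sigma> (\<Union>w\<in>V2. fst (h' w)) (\<Union>w\<in>V2. snd (h' w)) e = of_bool (e \<in> snd k) * off_factor V2 E \<sigma> e h"
proof -
  let ?u = "fst e" and ?D = "\<Union>w\<in>V2 - {v}. fst (h w)" and ?B = "\<Union>w\<in>V2 - {v}. snd (h w)"
  have D: "(\<Union>w\<in>V2. fst (h' w)) = fst k \<union> ?D" and B: "(\<Union>w\<in>V2. snd (h' w)) = snd k \<union> ?B"
    using e(3) by (auto simp: h'_def split: if_splits)
  have hw: "fst (h w) \<union> snd (h w) \<subseteq> edges_at2 E w" if "w \<in> V2 - {v}" for w
    using set_block(1)[OF E set_Pi_pmfD[OF _ h that]] V2 by simp
  have BE: "?B \<subseteq> E" using hw by (force simp: edges_at2_def)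
  have eB: "e \<notin> ?B" using hw e(2) by (fastforce simp: edges_at2_def)
  show ?thesis
  proof (cases "e \<in> snd k")
    case True
    \<comment> \<open>A red edge would be the only active edge of the block, but \<open>e\<close> is
      active and not red.\<close>
    have "d \<notin> fst k" for d
      using set_block(2)[OF E k] set_block(3)[OF E k, of d] True by blast
    then have "fst k = {}" by blast
    \<comment> \<open>An edge is determined by its endpoints, so the block of \<open>v\<close>
      contributes only \<open>e\<close> at \<open>?u\<close>.\<close>
    moreover have "edges_at1 (snd k \<union> ?B) ?u = insert e (edges_at1 (E \<inter> ?B) ?u)"
      using set_block(1)[OF E k] True BE e(2) by (auto simp: edges_at1_def edges_at2_def prod_eq_iff)
    ultimately show ?thesis using True e(2) by (simp add: blue_prob_def off_factor_def D B)
  next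
    case False
    then show ?thesis using eB by (simp add: blue_prob_def B)
  qed
qed

section \<open>The red/blue/gray scheme\<close>

locale rbg_setting =
  fixes V1 :: "'a set" and V2 :: "'b set" and E :: "('a \<times> 'b) set"
    and x \<rho> :: "'a \<times> 'b \<Rightarrow> real"
    and \<sigma>1 \<sigma>2 \<sigma>3 :: "'a \<Rightarrow> ('a \<times> 'b) set \<Rightarrow> ('a \<times> 'b) pmf"
  assumes graph: "bipartite_graph V1 V2 E"
    and x: "fractional_perfect_matching V1 V2 E x"
    and red: "\<And>e. e \<in> E \<Longrightarrow> measure_pmf.prob (colouring E x \<rho>) {(D, B, Y). e \<in> D}
                = 1 - exp (- x e / exp 1)"
    and rule1: "selection_rule V1 E \<sigma>1"
    and rule2: "selection_rule V1 E \<sigma>2" "monotone_rule V1 E \<sigma>2"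
    and rule3: "selection_rule V1 E \<sigma>3"
    and R1: "\<And>e. e \<in> E \<Longrightarrow> measure_pmf.prob (rbg_scheme V1 E x \<rho> \<sigma>1 \<sigma>2 \<sigma>3) {(R, R1, R2, R3). e \<in> R1}
               = (1 - exp (- 1 / exp 1)) * x e"
    and R2: "\<And>e. e \<in> E \<Longrightarrow> measure_pmf.prob (rbg_scheme V1 E x \<rho> \<sigma>1 \<sigma>2 \<sigma>3) {(R, R1, R2, R3). e \<in> R2}
               = (exp (- 1 / exp 1) - exp (- 1)) * x e"
begin

abbreviation scheme where "scheme \<equiv> rbg_scheme V1 E x \<rho> \<sigma>1 \<sigma>2 \<sigma>3"
abbreviation state where "state \<equiv> Pi_pmf V2 ({}, {}) (block E x \<rho>)"
abbreviation rest where "rest v \<equiv> Pi_pmf (V2 - {v}) ({}, {}) (block E x \<rho>)"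
abbreviation blue_of where
  "blue_of h \<equiv> blue_selection V1 \<sigma>2 (\<Union>w\<in>V2. fst (h w)) (\<Union>w\<in>V2. snd (h w))"

text \<open>The conditional probability that \<open>e\<close> enters \<open>R2\<close> given that it
  is blue: the blocks averaged here are independent of the block that decides the colour of
  \<open>e\<close>.\<close>

definition rate where "rate e = measure_pmf.expectation (rest (snd e)) (off_factor V2 E \<sigma>2 e)"

lemma finite_V1: "finite V1" and finite_V2: "finite V2" and E_subset: "E \<subseteq> V1 \<times> V2"
  using graph by (auto simp: bipartite_graph_def)

lemma finite_E: "finite E"
  using finite_V1 finite_V2 E_subset finite_subset by blast

lemma x_bounds: "e \<in> E \<Longrightarrow> 0 < x e \<and> x e \<le> 1"
  using x by (auto simp: fractional_perfect_matching_def)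

lemma fst_in_V1: "e \<in> E \<Longrightarrow> fst e \<in> V1" and snd_in_V2: "e \<in> E \<Longrightarrow> snd e \<in> V2"
  using E_subset by auto

lemma finite_rest: "finite (set_pmf (rest v))" and finite_state: "finite (set_pmf state)"
  using finite_V2 finite_E by (auto intro!: finite_set_Pi_pmf finite_set_block)

lemma exp_consts: "exp (- 1 / exp 1) = exp (- inv_e)" "exp (- y / exp 1) = exp (- inv_e * y)"
  by (simp_all add: inv_e_def exp_minus divide_inverse mult.commute)

lemma map_colouring: "map_pmf (\<lambda>(D, B, Y). (D, B)) (colouring E x \<rho>) =
     map_pmf (\<lambda>h. (\<Union>w\<in>V2. fst (h w), \<Union>w\<in>V2. snd (h w))) state"
  using x_bounds by (rule colouring_red_blue[OF finite_E E_subset finite_V2])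

text \<open>Taking the \<open>R2\<close> component commutes with the product over \<open>V1\<close>,
  and the resulting choice depends only on red and blue edges, hence only on the independent
  blocks.\<close>

lemma map_R2_scheme: "map_pmf (\<lambda>(R, R1, R2, R3). R2) scheme = bind_pmf state blue_of"
proof -
  have sel: "map_pmf (\<lambda>s. \<Union>u\<in>V1. fst (snd (s u))) (Pi_pmf V1 ({}, {}, {}) (select_at \<sigma>1 \<sigma>2 \<sigma>3 D B Y))
      = blue_selection V1 \<sigma>2 D B" for D B Y
  proof -
    have "blue_choice \<sigma>2 D B = (\<lambda>u. map_pmf (fst \<circ> snd) (select_at \<sigma>1 \<sigma>2 \<sigma>3 D B Y u))"
      by (auto simp: fun_eq_iff blue_choice_def select_at_def map_pmf_comp)
    then have "Pi_pmf V1 {} (blue_choice \<sigma>2 D B) =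
        map_pmf (\<lambda>h. (fst \<circ> snd) \<circ> h) (Pi_pmf V1 ({}, {}, {}) (select_at \<sigma>1 \<sigma>2 \<sigma>3 D B Y))"
      using finite_V1 by (simp add: Pi_pmf_map[where dflt = "({}, {}, {})"])
    then show ?thesis by (simp add: blue_selection_def map_pmf_comp)
  qed
  have "map_pmf (\<lambda>(R, R1, R2, R3). R2) scheme =
      bind_pmf (colouring E x \<rho>) (\<lambda>(D, B, Y). map_pmf (\<lambda>s. \<Union>u\<in>V1. fst (snd (s u)))
        (Pi_pmf V1 ({}, {}, {}) (select_at \<sigma>1 \<sigma>2 \<sigma>3 D B Y)))"
    by (simp add: rbg_scheme_def map_bind_pmf map_pmf_def bind_assoc_pmf bind_return_pmf case_prod_unfold)
  also have "\<dots> = bind_pmf (map_pmf (\<lambda>(D, B, Y). (D, B)) (colouring E x \<rho>)) (\<lambda>(D, B). blue_selection V1 \<sigma>2 D B)"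
    unfolding sel by (simp add: bind_map_pmf case_prod_unfold)
  also have "\<dots> = bind_pmf state blue_of"
    unfolding map_colouring
    by (simp add: bind_map_pmf)
  finally show ?thesis .
qed

lemma prob_R2:
  "measure_pmf.prob scheme {(R, R1, R2, R3). P R2} =
     measure_pmf.expectation state (\<lambda>h. measure_pmf.prob (blue_of h) {X. P X})"
proof -
  have "measure_pmf.prob scheme {(R, R1, R2, R3). P R2} =
      measure_pmf.prob (map_pmf (\<lambda>(R, R1, R2, R3). R2) scheme) {X. P X}"
    by (simp add: vimage_def case_prod_unfold)
  then show ?thesis by (simp add: map_R2_scheme prob_bind_pmf)
qed

section \<open>Conditioning on the block of one vertex of \<open>V2\<close>\<close>

lemma expectation_state:
  fixes F :: "_ \<Rightarrow> real"
  assumes "v \<in> V2"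
  shows "measure_pmf.expectation state F =
     measure_pmf.expectation (block E x \<rho> v) (\<lambda>k. measure_pmf.expectation (rest v) (\<lambda>h. F (h(v := k))))"
proof -
  have V2: "V2 = insert v (V2 - {v})" using assms by auto
  have "state = bind_pmf (block E x \<rho> v) (\<lambda>k. map_pmf (\<lambda>h. h(v := k)) (rest v))"
    by (subst V2, subst Pi_pmf_insert') (use finite_V2 in \<open>auto simp: map_pmf_def\<close>)
  moreover have "measure_pmf.expectation (bind_pmf (block E x \<rho> v) (\<lambda>k. map_pmf (\<lambda>h. h(v := k)) (rest v))) F =
      measure_pmf.expectation (block E x \<rho> v) (\<lambda>k. measure_pmf.expectation (map_pmf (\<lambda>h. h(v := k)) (rest v)) F)"
    using finite_rest finite_set_block[OF finite_E] by (intro expectation_bind_pmf_finite) auto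
  ultimately show ?thesis by simp
qed

lemma state_subset:
  assumes "h \<in> set_pmf state" "w \<in> V2"
  shows "fst (h w) \<union> snd (h w) \<subseteq> edges_at2 E w"
  using set_block(1)[OF finite_E set_Pi_pmfD[OF finite_V2 assms]] .

lemma state_blue_subset: "h \<in> set_pmf state \<Longrightarrow> (\<Union>w\<in>V2. snd (h w)) \<subseteq> E"
  using state_subset by (fastforce simp: edges_at2_def)

lemma set_state_upd:
  assumes "v \<in> V2" "k \<in> set_pmf (block E x \<rho> v)" "h \<in> set_pmf (rest v)"
  shows "h(v := k) \<in> set_pmf state"
  using assms finite_V2 by (auto simp: set_Pi_pmf PiE_dflt_def)

lemma prob_red:
  assumes e: "e \<in> E"
  shows "measure_pmf.prob (block E x \<rho> (snd e)) {k. e \<in> fst k} = 1 - exp (- inv_e * x e)"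
proof -
  have "1 - exp (- inv_e * x e) = measure_pmf.prob (colouring E x \<rho>) {(D, B, Y). e \<in> D}"
    using red[OF e] exp_consts by simp
  also have "\<dots> = measure_pmf.prob (map_pmf (\<lambda>(D, B, Y). (D, B)) (colouring E x \<rho>)) {p. e \<in> fst p}"
    by (simp add: vimage_def case_prod_unfold)
  also have "\<dots> = measure_pmf.prob state {h. e \<in> (\<Union>w\<in>V2. fst (h w))}"
    unfolding map_colouring by (simp add: vimage_def)
  also have "\<dots> = measure_pmf.prob state {h. e \<in> fst (h (snd e))}"
  proof (rule prob_cong_pmf)
    fix h assume h: "h \<in> set_pmf state"
    have "w = snd e" if "w \<in> V2" "e \<in> fst (h w)" for w
      using state_subset[OF h that(1)] that(2) by (auto simp: edges_at2_def)
    then show "h \<in> {h. e \<in> (\<Union>w\<in>V2. fst (h w))} \<longleftrightarrow> h \<in> {h. e \<in> fst (h (snd e))}"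
      using snd_in_V2[OF e] by auto
  qed
  also have "\<dots> = measure_pmf.prob (map_pmf (\<lambda>h. h (snd e)) state) {k. e \<in> fst k}"
    by (simp add: vimage_def)
  also have "\<dots> = measure_pmf.prob (block E x \<rho> (snd e)) {k. e \<in> fst k}"
    using finite_V2 snd_in_V2[OF e] by (simp add: Pi_pmf_component)
  finally show ?thesis by simp
qed

text \<open>An active edge is either red or blue, so the probability of red is subtracted from that
  of active.\<close>

lemma prob_blue:
  assumes e: "e \<in> E"
  shows "measure_pmf.prob (block E x \<rho> (snd e)) {k. e \<in> snd k} = exp (- inv_e * x e) - exp (- x e)"
proof -
  let ?K = "block E x \<rho> (snd e)"
  have "measure_pmf.prob ?K {k. {e} \<subseteq> fst k \<union> snd k} = 1 - exp (- x e)"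
    using prob_block_superset[OF finite_E x_bounds, where Y = "{e}" and \<rho> = \<rho> and w = "snd e"] e
    by (simp add: edges_at2_def)
  moreover have "{k. {e} \<subseteq> fst k \<union> snd k} = {k. e \<in> fst k} \<union> {k. e \<in> snd k \<and> e \<notin> fst k}" by auto
  moreover have "measure_pmf.prob ?K ({k. e \<in> fst k} \<union> {k. e \<in> snd k \<and> e \<notin> fst k}) =
      measure_pmf.prob ?K {k. e \<in> fst k} + measure_pmf.prob ?K {k. e \<in> snd k \<and> e \<notin> fst k}"
    by (intro measure_pmf.finite_measure_Union) auto
  moreover have "measure_pmf.prob ?K {k. e \<in> snd k \<and> e \<notin> fst k} = measure_pmf.prob ?K {k. e \<in> snd k}"
    using set_block(2)[OF finite_E] by (intro prob_cong_pmf) blast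
  ultimately show ?thesis using prob_red[OF e] by simp
qed

lemma rate_bounds: "0 \<le> rate e" "rate e \<le> 1"
proof -
  show "0 \<le> rate e" unfolding rate_def by (intro Bochner_Integration.integral_nonneg off_factor_bounds(1))
  have "rate e \<le> measure_pmf.expectation (rest (snd e)) (\<lambda>_. 1)"
    unfolding rate_def using finite_rest off_factor_bounds(2) by (intro expectation_mono_pmf)
  then show "rate e \<le> 1" by simp
qed

lemma blue_prob_upd:
  assumes "e \<in> E" "snd e = v" "k \<in> set_pmf (block E x \<rho> v)" "h \<in> set_pmf (rest v)"
  shows "blue_prob \<sigma>2 (\<Union>w\<in>V2. fst ((h(v := k)) w)) (\<Union>w\<in>V2. snd ((h(v := k)) w)) e =
     of_bool (e \<in> snd k) * off_factor V2 E \<sigma>2 e h"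
  using blue_prob_state[OF finite_E finite_V2 assms(1,2) _ assms(3,4)] snd_in_V2[OF assms(1)] assms(2) by simp

text \<open>The prescribed probability of \<open>e \<in> R2\<close> factors into the probability
  that \<open>e\<close> is blue and \<open>rate e\<close>; dividing by the former reduces the claim
  to \<open>rate_lower\<close>.\<close>

lemma rate_ge:
  assumes e: "e \<in> E"
  shows "q0 * (1 + x e / 2) \<le> rate e"
proof -
  let ?v = "snd e"
  have "(exp (- inv_e) - inv_e) * x e = measure_pmf.prob scheme {(R, R1, R2, R3). e \<in> R2}"
    using R2[OF e] exp_consts(1) by (simp add: inv_e_def)
  also have "\<dots> = measure_pmf.expectation state (\<lambda>h. measure_pmf.prob (blue_of h) {X. e \<in> X})"
    by (rule prob_R2)
  also have "\<dots> = measure_pmf.expectation state (\<lambda>h. blue_prob \<sigma>2 (\<Union>w\<in>V2. fst (h w)) (\<Union>w\<in>V2. snd (h w)) e)"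
    using rule2(1) finite_V1 fst_in_V1[OF e] state_blue_subset
    by (intro expectation_cong_pmf prob_blue_selection) auto
  also have "\<dots> = measure_pmf.expectation (block E x \<rho> ?v) (\<lambda>k. measure_pmf.expectation (rest ?v)
      (\<lambda>h. of_bool (e \<in> snd k) * off_factor V2 E \<sigma>2 e h))"
    unfolding expectation_state[OF snd_in_V2[OF e]]
    by (intro expectation_cong_pmf blue_prob_upd[OF e refl])
  also have "\<dots> = measure_pmf.expectation (block E x \<rho> ?v) (\<lambda>k. of_bool (e \<in> snd k) * rate e)"
    by (simp add: rate_def)
  also have "\<dots> = (exp (- inv_e * x e) - exp (- x e)) * rate e"
    using prob_blue[OF e] by (simp add: expectation_of_bool_pmf)
  finally have eq: "(exp (- inv_e) - inv_e) * x e = (exp (- inv_e * x e) - exp (- x e)) * rate e" .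
  have pos: "exp (- inv_e * x e) - exp (- x e) > 0"
    using x_bounds[OF e] inv_e_bounds by simp
  have "rate e = (exp (- inv_e) - inv_e) * x e / (exp (- inv_e * x e) - exp (- x e))"
    unfolding eq by (rule nonzero_mult_div_cancel_left[symmetric]) (use pos in linarith)
  then show ?thesis using rate_lower[of "x e"] x_bounds[OF e] by simp
qed

lemma blue_hit_single:
  assumes e: "e \<in> E" "snd e = v" and k: "k \<in> set_pmf (block E x \<rho> v)" and "e \<in> snd k" "e \<in> T"
  shows "rate e \<le> measure_pmf.expectation (rest v) (\<lambda>h. measure_pmf.prob (blue_of (h(v := k))) {X. X \<inter> T \<noteq> {}})"
proof -
  have v: "v \<in> V2" using snd_in_V2[OF e(1)] e(2) by simp
  have "off_factor V2 E \<sigma>2 e h \<le> measure_pmf.prob (blue_of (h(v := k))) {X. X \<inter> T \<noteq> {}}"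
    if h: "h \<in> set_pmf (rest v)" for h
  proof -
    have "off_factor V2 E \<sigma>2 e h = measure_pmf.prob (blue_of (h(v := k))) {X. e \<in> X}"
      using blue_prob_upd[OF e k h] \<open>e \<in> snd k\<close> state_blue_subset[OF set_state_upd[OF v k h]]
      by (subst prob_blue_selection[OF rule2(1) finite_V1 fst_in_V1[OF e(1)]]) auto
    also have "\<dots> \<le> measure_pmf.prob (blue_of (h(v := k))) {X. X \<inter> T \<noteq> {}}"
      using \<open>e \<in> T\<close> by (intro measure_pmf.finite_measure_mono) auto
    finally show ?thesis .
  qed
  then show ?thesis unfolding rate_def e(2) using finite_rest by (intro expectation_mono_pmf)
qed

text \<open>For fixed colours the two choices are independent. Averaging over the other blocks makes
  the product of the two factors at most \<open>rate e * rate e'\<close> by negative correlation, so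
  the chance of at least one hit is at least the independent value.\<close>

lemma blue_hit_pair:
  assumes e: "e \<in> E" "snd e = v" and e': "e' \<in> E" "snd e' = v" "e \<noteq> e'"
    and k: "k \<in> set_pmf (block E x \<rho> v)" and "e \<in> snd k" "e \<in> T" "e' \<in> snd k" "e' \<in> T"
  shows "1 - (1 - rate e) * (1 - rate e')
      \<le> measure_pmf.expectation (rest v) (\<lambda>h. measure_pmf.prob (blue_of (h(v := k))) {X. X \<inter> T \<noteq> {}})"
proof -
  have v: "v \<in> V2" using snd_in_V2[OF e(1)] e(2) by simp
  have ne: "fst e \<noteq> fst e'" using e e' by (auto simp: prod_eq_iff)
  let ?f = "off_factor V2 E \<sigma>2 e" and ?g = "off_factor V2 E \<sigma>2 e'"
  have int: "integrable (measure_pmf (rest v)) F" for F :: "_ \<Rightarrow> real"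
    using finite_rest by (rule integrable_measure_pmf_finite)
  have "measure_pmf.expectation (rest v) (\<lambda>h. ?f h * ?g h) \<le> rate e * rate e'"
    unfolding rate_def e(2) e'(2)
    using ne finite_V2 off_factor_antimono[OF rule2(2) e(1) fst_in_V1[OF e(1)]]
      off_factor_antimono[OF rule2(2) e'(1) fst_in_V1[OF e'(1)]]
    by (intro negative_correlation_state[OF finite_E x_bounds, where u = "fst e" and u' = "fst e'"]) auto
  moreover have "measure_pmf.expectation (rest v) (\<lambda>h. 1 - (1 - ?f h) * (1 - ?g h)) =
      rate e + rate e' - measure_pmf.expectation (rest v) (\<lambda>h. ?f h * ?g h)"
    unfolding rate_def e(2) e'(2) by (simp add: algebra_simps int)
  moreover have "measure_pmf.expectation (rest v) (\<lambda>h. 1 - (1 - ?f h) * (1 - ?g h)) \<le>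
      measure_pmf.expectation (rest v) (\<lambda>h. measure_pmf.prob (blue_of (h(v := k))) {X. X \<inter> T \<noteq> {}})"
  proof (rule expectation_mono_pmf[OF finite_rest])
    fix h assume h: "h \<in> set_pmf (rest v)"
    let ?D = "\<Union>w\<in>V2. fst ((h(v := k)) w)" and ?B = "\<Union>w\<in>V2. snd ((h(v := k)) w)"
    have f: "?f h = blue_prob \<sigma>2 ?D ?B e" and g: "?g h = blue_prob \<sigma>2 ?D ?B e'"
      using blue_prob_upd[OF e k h] blue_prob_upd[OF e'(1,2) k h] \<open>e \<in> snd k\<close> \<open>e' \<in> snd k\<close> by simp_all
    show "1 - (1 - ?f h) * (1 - ?g h) \<le> measure_pmf.prob (blue_of (h(v := k))) {X. X \<inter> T \<noteq> {}}"
      unfolding f g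
      by (rule prob_blue_selection_pair[OF rule2(1) finite_V1 state_blue_subset[OF set_state_upd[OF v k h]]
          fst_in_V1[OF e(1)] fst_in_V1[OF e'(1)] ne \<open>e \<in> T\<close> \<open>e' \<in> T\<close>])
  qed
  ultimately show ?thesis by (simp add: algebra_simps)
qed

end

section \<open>Indicator sums and the gain from two blue edges\<close>

lemma sum_singleton_indicator:
  fixes c :: "'i \<Rightarrow> real"
  assumes "finite T"
  shows "(\<Sum>e\<in>T. c e * of_bool (Y = {e})) = (if \<exists>e\<in>T. Y = {e} then c (the_elem Y) else 0)"
proof (cases "\<exists>e\<in>T. Y = {e}")
  case True
  then obtain d where d: "d \<in> T" "Y = {d}" by blast
  have "(\<Sum>e\<in>T. c e * of_bool (Y = {e})) = (\<Sum>e\<in>T. if e = d then c e else 0)"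
    unfolding d(2) by (intro sum.cong) auto
  with True d assms show ?thesis by simp
qed (auto intro!: sum.neutral)

lemma sum_pair_indicator:
  fixes c :: "'i \<Rightarrow> real"
  assumes "finite T" "a \<in> T" "b \<in> T" "a \<noteq> b"
  shows "(\<Sum>e\<in>T. c e * (\<Sum>e'\<in>T - {e}. of_bool ({a, b} = {e, e'}))) = c a + c b"
proof -
  have inner: "(\<Sum>e'\<in>T - {e}. of_bool ({a, b} = {e, e'})) = (of_bool (e \<in> {a, b}) :: real)" if "e \<in> T" for e
  proof (cases "e \<in> {a, b}")
    case True
    then obtain e'' where e'': "{a, b} = {e, e''}" "e'' \<noteq> e" "e'' \<in> T" using assms by fastforce
    have "(\<Sum>e'\<in>T - {e}. of_bool ({a, b} = {e, e'})) = (\<Sum>e'\<in>T - {e}. if e' = e'' then 1 else 0 :: real)"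
      unfolding e''(1) using e''(2) by (intro sum.cong) (auto simp: doubleton_eq_iff)
    with True e'' assms show ?thesis by simp
  next
    case False
    then show ?thesis by (auto intro!: sum.neutral)
  qed
  have "(\<Sum>e\<in>T. c e * (\<Sum>e'\<in>T - {e}. of_bool ({a, b} = {e, e'}))) = (\<Sum>e\<in>T. if e \<in> {a, b} then c e else 0)"
    using inner by (intro sum.cong) auto
  also have "\<dots> = (\<Sum>e\<in>{a, b}. c e)"
    using assms by (intro sum.inter_restrict[symmetric, THEN trans] sum.cong) auto
  finally show ?thesis using assms by simp
qed

text \<open>The linear gain over \<open>Q0\<close> is \<open>2 * k0 * (x + y)\<close>. Half of it is
  kept and the other half absorbs the negative term in \<open>x * y\<close>, using
  \<open>x * y \<le> (x + y) / 2\<close> and \<open>q0 \<le> 2/3\<close>.\<close>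

lemma pair_bound:
  fixes x y :: real
  assumes "0 \<le> x" "x \<le> 1" "0 \<le> y" "y \<le> 1"
    and "q0 * (1 + x / 2) \<le> r" "q0 * (1 + y / 2) \<le> s" "r \<le> 1" "s \<le> 1"
  shows "Q0 + k0 * (x + y) \<le> 1 - (1 - r) * (1 - s)"
proof -
  have "(1 - r) * (1 - s) \<le> (1 - q0 * (1 + x / 2)) * (1 - q0 * (1 + y / 2))"
    using assms by (intro mult_mono) auto
  also have "\<dots> = 1 - Q0 - k0 * (x + y) - q0 / 4 * ((1 - q0) * (x + y) - q0 * (x * y))"
    by (simp add: Q0_def k0_def field_simps power2_eq_square)
  also have "\<dots> \<le> 1 - Q0 - k0 * (x + y)"
  proof -
    have "x * y \<le> x" "x * y \<le> y" using assms by (auto simp: mult_left_le mult_left_le_one_le)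
    then have "q0 * (x * y) \<le> q0 * ((x + y) / 2)" using q0_bounds by (intro mult_left_mono) auto
    also have "\<dots> \<le> (1 - q0) * (x + y)"
      using mult_right_mono[of "q0 / 2" "1 - q0" "x + y"] q0_bounds assms by simp
    finally show ?thesis using q0_bounds by simp
  qed
  finally show ?thesis by simp
qed

section \<open>The probability that \<open>R2\<close> meets a set of edges at a vertex\<close>

context rbg_setting
begin

text \<open>The left-hand side is \<open>q0 * (1 + x e / 2)\<close> if \<open>e\<close> is the only blue edge in \<open>T\<close>, it is \<open>Q0\<close> plus a gain
  if there are exactly two, and \<open>Q0\<close> if there are more; the term with \<open>fst k\<close> cancels the contribution of an
  active set consisting of a red edge.\<close>
lemma blue_hit_pointwise:
  assumes v: "v \<in> V2" and T: "T \<subseteq> edges_at2 E v" and k: "k \<in> set_pmf (block E x \<rho> v)"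
  defines "Y \<equiv> (fst k \<union> snd k) \<inter> T"
  shows "Q0 * (1 - of_bool (Y = {}) - (\<Sum>e\<in>T. of_bool (Y = {e})))
      + (\<Sum>e\<in>T. q0 * (1 + x e / 2) * (of_bool (Y = {e}) - of_bool (e \<in> fst k)))
      + k0 * (\<Sum>e\<in>T. x e * (\<Sum>e'\<in>T - {e}. of_bool (Y = {e, e'})))
    \<le> measure_pmf.expectation (rest v) (\<lambda>h. measure_pmf.prob (blue_of (h(v := k))) {X. X \<inter> T \<noteq> {}})"
    (is "?L \<le> ?H")
proof -
  have finT: "finite T" using T finite_edges_at2[OF finite_E] by (rule finite_subset)
  have TE: "e \<in> E" "snd e = v" if "e \<in> T" for e using T that by (auto simp: edges_at2_def)
  have H0: "0 \<le> ?H" by (intro Bochner_Integration.integral_nonneg) simp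
  have YT: "Y \<subseteq> T" by (auto simp: Y_def)
  then have finY: "finite Y" using finT by (rule finite_subset)
  have singles: "(\<Sum>e\<in>T. of_bool (Y = {e})) = (if \<exists>e\<in>T. Y = {e} then 1 else 0 :: real)"
    using sum_singleton_indicator[OF finT, of "\<lambda>_. 1" Y] by simp
  have no_pair: "(\<Sum>e\<in>T. x e * (\<Sum>e'\<in>T - {e}. of_bool (Y = {e, e'}))) = 0" if "card Y \<noteq> 2"
  proof (intro sum.neutral ballI)
    fix e assume "e \<in> T"
    have "Y \<noteq> {e, e'}" if "e' \<in> T - {e}" for e' using \<open>card Y \<noteq> 2\<close> that by auto
    then show "x e * (\<Sum>e'\<in>T - {e}. of_bool (Y = {e, e'})) = 0" by simp
  qed
  show ?thesis
  proof (cases "fst k = {}")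
    case False
    then obtain d where d: "d \<in> fst k" by blast
    then have dk: "fst k \<union> snd k = {d}" by (rule set_block(3)[OF finite_E k])
    then have fk: "fst k = {d}" using d by auto
    have Y: "Y = (if d \<in> T then {d} else {})" using dk by (auto simp: Y_def)
    have "card Y \<noteq> 2" using Y by simp
    moreover have "of_bool (Y = {e}) = (of_bool (e \<in> fst k) :: real)" if "e \<in> T" for e
      using that unfolding Y fk by auto
    moreover have "of_bool (Y = {}) + (if \<exists>e\<in>T. Y = {e} then 1 else 0) = (1 :: real)"
      unfolding Y by auto
    ultimately have "?L = 0" unfolding singles using no_pair by simp
    then show ?thesis using H0 by simp
  next
    case True
    then have Yk: "Y = snd k \<inter> T" by (simp add: Y_def)
    have L: "?L = Q0 * (1 - of_bool (Y = {}) - (if \<exists>e\<in>T. Y = {e} then 1 else 0))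
      + (\<Sum>e\<in>T. q0 * (1 + x e / 2) * of_bool (Y = {e}))
      + k0 * (\<Sum>e\<in>T. x e * (\<Sum>e'\<in>T - {e}. of_bool (Y = {e, e'})))"
      unfolding singles using True by simp
    consider "Y = {}" | e where "Y = {e}" | a b where "a \<in> Y" "b \<in> Y" "a \<noteq> b" by blast
    then show ?thesis
    proof cases
      case 1
      then have "?L = 0" unfolding L using no_pair by simp
      then show ?thesis using H0 by simp
    next
      case (2 e)
      then have e: "e \<in> T" "e \<in> snd k" using Yk by auto
      have "(\<Sum>e\<in>T. q0 * (1 + x e / 2) * of_bool (Y = {e})) = q0 * (1 + x e / 2)"
        using sum_singleton_indicator[OF finT, of "\<lambda>e. q0 * (1 + x e / 2)" Y] 2 e by auto
      then have "?L = q0 * (1 + x e / 2)" unfolding L using no_pair 2 e by auto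
      also have "\<dots> \<le> rate e" using TE[OF e(1)] by (intro rate_ge)
      also have "\<dots> \<le> ?H" using e by (intro blue_hit_single TE k)
      finally show ?thesis .
    next
      case (3 a b)
      then have ab: "a \<in> T" "b \<in> T" "a \<in> snd k" "b \<in> snd k" using Yk by auto
      have "1 - (1 - rate a) * (1 - rate b) \<le> ?H"
        using ab 3 by (intro blue_hit_pair TE k)
      moreover have "Q0 + k0 * (x a + x b) \<le> 1 - (1 - rate a) * (1 - rate b)"
        using x_bounds[OF TE(1)[OF ab(1)]] x_bounds[OF TE(1)[OF ab(2)]]
        by (intro pair_bound rate_ge rate_bounds TE ab) auto
      moreover have "?L \<le> Q0 + k0 * (x a + x b)"
      proof -
        have ns: "Y \<noteq> {}" "\<not> (\<exists>e\<in>T. Y = {e})" using 3 by auto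
        have L': "?L = Q0 + k0 * (\<Sum>e\<in>T. x e * (\<Sum>e'\<in>T - {e}. of_bool (Y = {e, e'})))"
          unfolding L using ns by (simp add: sum.neutral)
        show ?thesis
        proof (cases "card Y = 2")
          case True
          have "Y = {a, b}" using card_subset_eq[OF finY, of "{a, b}"] True 3 by simp
          then show ?thesis unfolding L' using sum_pair_indicator[OF finT ab(1,2) 3(3), of x] by simp
        next
          case False
          have "0 \<le> x a + x b" using x_bounds[OF TE(1)[OF ab(1)]] x_bounds[OF TE(1)[OF ab(2)]] by simp
          then show ?thesis unfolding L' unfolding no_pair[OF False] using k0_bounds by simp
        qed
      qed
      ultimately show ?thesis by linarith
    qed
  qed
qed

text \<open>Since \<open>1 - exp (- x e) = exp (- x e) * (exp (x e) - 1)\<close>, a factor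
  \<open>exp (- x e)\<close> comes out for every edge of \<open>T\<close>, active or not.\<close>

lemma prob_active:
  assumes T: "T \<subseteq> edges_at2 E v" and Z: "Z \<subseteq> T"
  shows "measure_pmf.prob (block E x \<rho> v) {k. (fst k \<union> snd k) \<inter> T = Z} = exp (- sum x T) * (\<Prod>e\<in>Z. exp (x e) - 1)"
proof -
  have finT: "finite T" using T finite_edges_at2[OF finite_E] by (rule finite_subset)
  have TE: "e \<in> E" if "e \<in> T" for e using T that by (auto simp: edges_at2_def)
  have "measure_pmf.prob (block E x \<rho> v) {k. (fst k \<union> snd k) \<inter> T = Z} =
      measure_pmf.prob (random_subset (edges_at2 E v) (\<lambda>e. 1 - exp (- x e))) {X. X \<inter> T = Z}"
    by (subst map_union_block[OF finite_E, where \<rho> = \<rho>, symmetric]) (simp add: vimage_def)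
  also have "\<dots> = (\<Prod>e\<in>T. if e \<in> Z then 1 - exp (- x e) else 1 - (1 - exp (- x e)))"
    using x_bounds TE by (intro prob_random_subset_Int finite_edges_at2[OF finite_E] T Z) force
  also have "\<dots> = (\<Prod>e\<in>T. exp (- x e) * (if e \<in> Z then exp (x e) - 1 else 1))"
    by (intro prod.cong) (auto simp: algebra_simps simp flip: exp_add)
  also have "\<dots> = (\<Prod>e\<in>T. exp (- x e)) * (\<Prod>e\<in>T. if e \<in> Z then exp (x e) - 1 else 1)"
    by (rule prod.distrib)
  also have "(\<Prod>e\<in>T. exp (- x e)) = exp (- sum x T)"
    using finT by (simp add: exp_sum sum_negf[symmetric])
  also have "(\<Prod>e\<in>T. if e \<in> Z then exp (x e) - 1 else 1) = (\<Prod>e\<in>Z. exp (x e) - 1)"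
    using finT Z by (simp add: prod.inter_restrict[symmetric] Int_absorb1)
  finally show ?thesis .
qed

text \<open>The pointwise bound is averaged over the block of \<open>v\<close>; the indicators
  become the probabilities of empty, one-element and two-element active sets in \<open>T\<close> and
  of red edges.\<close>

lemma R2_hit:
  assumes v: "v \<in> V2" and T: "T \<subseteq> edges_at2 E v"
  defines "t \<equiv> sum x T"
  shows "Q0 * (1 - exp (- t) - exp (- t) * (\<Sum>e\<in>T. exp (x e) - 1))
     + (\<Sum>e\<in>T. q0 * (1 + x e / 2) * (exp (- t) * (exp (x e) - 1) - (1 - exp (- inv_e * x e))))
     + k0 * exp (- t) * (\<Sum>e\<in>T. x e * (exp (x e) - 1) * (\<Sum>e'\<in>T - {e}. exp (x e') - 1))
   \<le> measure_pmf.prob scheme {(R, R1, R2, R3). R2 \<inter> T \<noteq> {}}"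
proof -
  let ?K = "block E x \<rho> v"
  have finT: "finite T" using T finite_edges_at2[OF finite_E] by (rule finite_subset)
  have TE: "e \<in> E" "snd e = v" if "e \<in> T" for e using T that by (auto simp: edges_at2_def)
  have int: "integrable (measure_pmf ?K) f" for f :: "_ \<Rightarrow> real"
    by (intro integrable_measure_pmf_finite finite_set_block finite_E)
  have act: "measure_pmf.expectation ?K (\<lambda>k. of_bool ((fst k \<union> snd k) \<inter> T = Z)) = exp (- t) * (\<Prod>e\<in>Z. exp (x e) - 1)"
    if "Z \<subseteq> T" for Z
    unfolding expectation_of_bool_pmf t_def by (rule prob_active[OF T that])
  have redp: "measure_pmf.expectation ?K (\<lambda>k. of_bool (e \<in> fst k)) = 1 - exp (- inv_e * x e)" if "e \<in> T" for e
    unfolding expectation_of_bool_pmf using prob_red[OF TE(1)[OF that]] TE(2)[OF that] by simp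
  let ?Y = "\<lambda>k. (fst k \<union> snd k) \<inter> T"
  have "measure_pmf.expectation ?K (\<lambda>k. Q0 * (1 - of_bool (?Y k = {}) - (\<Sum>e\<in>T. of_bool (?Y k = {e})))
      + (\<Sum>e\<in>T. q0 * (1 + x e / 2) * (of_bool (?Y k = {e}) - of_bool (e \<in> fst k)))
      + k0 * (\<Sum>e\<in>T. x e * (\<Sum>e'\<in>T - {e}. of_bool (?Y k = {e, e'}))))
    \<le> measure_pmf.expectation ?K (\<lambda>k. measure_pmf.expectation (rest v)
        (\<lambda>h. measure_pmf.prob (blue_of (h(v := k))) {X. X \<inter> T \<noteq> {}}))"
    by (intro expectation_mono_pmf finite_set_block finite_E blue_hit_pointwise v T)
  also have "\<dots> = measure_pmf.prob scheme {(R, R1, R2, R3). R2 \<inter> T \<noteq> {}}"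
    unfolding prob_R2 expectation_state[OF v] ..
  also have "measure_pmf.expectation ?K (\<lambda>k. Q0 * (1 - of_bool (?Y k = {}) - (\<Sum>e\<in>T. of_bool (?Y k = {e})))
      + (\<Sum>e\<in>T. q0 * (1 + x e / 2) * (of_bool (?Y k = {e}) - of_bool (e \<in> fst k)))
      + k0 * (\<Sum>e\<in>T. x e * (\<Sum>e'\<in>T - {e}. of_bool (?Y k = {e, e'})))) =
    Q0 * (1 - measure_pmf.expectation ?K (\<lambda>k. of_bool (?Y k = {})) - (\<Sum>e\<in>T. measure_pmf.expectation ?K (\<lambda>k. of_bool (?Y k = {e}))))
      + (\<Sum>e\<in>T. q0 * (1 + x e / 2) * (measure_pmf.expectation ?K (\<lambda>k. of_bool (?Y k = {e})) - measure_pmf.expectation ?K (\<lambda>k. of_bool (e \<in> fst k))))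
      + k0 * (\<Sum>e\<in>T. x e * (\<Sum>e'\<in>T - {e}. measure_pmf.expectation ?K (\<lambda>k. of_bool (?Y k = {e, e'}))))"
    by (simp add: int)
  also have "\<dots> = Q0 * (1 - exp (- t) - (\<Sum>e\<in>T. exp (- t) * (exp (x e) - 1)))
     + (\<Sum>e\<in>T. q0 * (1 + x e / 2) * (exp (- t) * (exp (x e) - 1) - (1 - exp (- inv_e * x e))))
     + k0 * (\<Sum>e\<in>T. x e * (\<Sum>e'\<in>T - {e}. exp (- t) * ((exp (x e) - 1) * (exp (x e') - 1))))"
  proof -
    have "measure_pmf.expectation ?K (\<lambda>k. of_bool (?Y k = {e, e'})) = exp (- t) * ((exp (x e) - 1) * (exp (x e') - 1))"
      if "e \<in> T" "e' \<in> T - {e}" for e e'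
    proof -
      have "e \<noteq> e'" using that by auto
      then show ?thesis using that act[of "{e, e'}"] by simp
    qed
    then show ?thesis using act[of "{}"] act[of "{_}"] redp by simp
  qed
  also have "\<dots> = Q0 * (1 - exp (- t) - exp (- t) * (\<Sum>e\<in>T. exp (x e) - 1))
     + (\<Sum>e\<in>T. q0 * (1 + x e / 2) * (exp (- t) * (exp (x e) - 1) - (1 - exp (- inv_e * x e))))
     + k0 * exp (- t) * (\<Sum>e\<in>T. x e * (exp (x e) - 1) * (\<Sum>e'\<in>T - {e}. exp (x e') - 1))"
    by (simp only: sum_distrib_left mult.assoc mult.left_commute[of _ "exp (- t)"])
  finally show ?thesis .
qed

end

section \<open>Support of the scheme and its hitting probabilities\<close>

lemma set_select_at:
  assumes "selection_rule V1 E \<sigma>1" "selection_rule V1 E \<sigma>2" "selection_rule V1 E \<sigma>3" "u \<in> V1"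
    and "D \<subseteq> E" "B \<subseteq> E" "Y \<subseteq> E" and r: "r \<in> set_pmf (select_at \<sigma>1 \<sigma>2 \<sigma>3 D B Y u)"
  shows "fst r \<subseteq> edges_at1 D u" "fst (snd r) \<subseteq> edges_at1 B u" "snd (snd r) \<subseteq> edges_at1 Y u"
    "\<exists>e. fst r \<union> fst (snd r) \<union> snd (snd r) \<subseteq> {e}"
proof -
  have sel: "set_pmf (\<sigma> u (edges_at1 S u)) \<subseteq> edges_at1 S u"
    if "selection_rule V1 E \<sigma>" "S \<subseteq> E" "edges_at1 S u \<noteq> {}" for \<sigma> S
  proof -
    have "edges_at1 S u \<subseteq> edges_at1 E u" using that(2) by (auto simp: edges_at1_def)
    then show ?thesis using that(1,3) \<open>u \<in> V1\<close> unfolding selection_rule_def by simp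
  qed
  show "fst r \<subseteq> edges_at1 D u" "fst (snd r) \<subseteq> edges_at1 B u" "snd (snd r) \<subseteq> edges_at1 Y u"
    "\<exists>e. fst r \<union> fst (snd r) \<union> snd (snd r) \<subseteq> {e}"
    using r sel[OF assms(1) assms(5)] sel[OF assms(2) assms(6)] sel[OF assms(3) assms(7)]
    by (auto simp: select_at_def split: if_splits)
qed

lemma set_colouring:
  assumes E: "finite E" and c: "(D, B, Y) \<in> set_pmf (colouring E x \<rho>)"
  shows "D \<union> B \<union> Y \<subseteq> E" "d \<in> D \<Longrightarrow> f \<in> D \<union> B \<Longrightarrow> snd f = snd d \<Longrightarrow> f = d"
proof -
  obtain R A where R: "R \<in> set_pmf (random_subset E x)"
    and A: "A \<in> set_pmf (random_subset R (\<lambda>e. (1 - exp (- x e)) / x e))"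
    and D: "D \<in> set_pmf (random_subset (lone_edges A) \<rho>)" and BY: "B = A - D" "Y = R - A"
    using c by (auto simp: colouring_def)
  have RE: "R \<subseteq> E" using E R by (rule set_random_subset)
  then have "finite R" using E by (rule finite_subset)
  then have AR: "A \<subseteq> R" using A by (rule set_random_subset)
  then have "finite A" using \<open>finite R\<close> by (rule finite_subset)
  then have "finite (lone_edges A)" by (rule finite_subset[OF lone_edges_subset])
  then have Dl: "D \<subseteq> lone_edges A" using D by (rule set_random_subset)
  then have DA: "D \<subseteq> A" using lone_edges_subset by (rule order_trans)
  show "D \<union> B \<union> Y \<subseteq> E" using RE AR DA BY by blast
  assume "d \<in> D" "f \<in> D \<union> B" "snd f = snd d"
  then have "edges_at2 A (snd d) = {d}" "f \<in> edges_at2 A (snd d)"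
    using Dl DA BY by (auto simp: lone_edges_def edges_at2_def)
  then show "f = d" by simp
qed

context rbg_setting
begin

text \<open>Each \<open>u\<close> contributes at most one edge, which gives the matching property on
  the side of \<open>V1\<close>. A red edge excludes other active edges at its vertex of
  \<open>V2\<close>; gray edges may still occur there, so that claim concerns
  \<open>R1 \<union> R2\<close> only.\<close>

lemma scheme_support:
  assumes "(R, R1, R2, R3) \<in> set_pmf scheme"
  shows "R1 \<union> R2 \<union> R3 \<subseteq> R" "R \<subseteq> E"
    "e \<in> R1 \<union> R2 \<union> R3 \<Longrightarrow> f \<in> R1 \<union> R2 \<union> R3 \<Longrightarrow> fst e = fst f \<Longrightarrow> e = f"
    "d \<in> R1 \<Longrightarrow> f \<in> R1 \<union> R2 \<Longrightarrow> snd f = snd d \<Longrightarrow> f = d" "R1 \<inter> R2 = {}"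
proof -
  obtain D B Y s where c: "(D, B, Y) \<in> set_pmf (colouring E x \<rho>)"
    and s: "s \<in> set_pmf (Pi_pmf V1 ({}, {}, {}) (select_at \<sigma>1 \<sigma>2 \<sigma>3 D B Y))"
    and R: "R = D \<union> B \<union> Y" and R1: "R1 = (\<Union>u\<in>V1. fst (s u))"
    and R2: "R2 = (\<Union>u\<in>V1. fst (snd (s u)))" and R3: "R3 = (\<Union>u\<in>V1. snd (snd (s u)))"
    using assms by (auto simp: rbg_scheme_def)
  have sub: "D \<subseteq> E" "B \<subseteq> E" "Y \<subseteq> E" using set_colouring(1)[OF finite_E c] by auto
  note sel = set_select_at[OF rule1 rule2(1) rule3 _ sub set_Pi_pmfD[OF finite_V1 s]]
  have 1: "fst (s u) \<subseteq> edges_at1 D u" "fst (snd (s u)) \<subseteq> edges_at1 B u" "snd (snd (s u)) \<subseteq> edges_at1 Y u"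
    if "u \<in> V1" for u using sel(1-3)[OF that that] .
  have R1D: "R1 \<subseteq> D" and R2B: "R2 \<subseteq> B" and R3Y: "R3 \<subseteq> Y"
    unfolding R1 R2 R3 using 1 by (fastforce simp: edges_at1_def)+
  then show "R1 \<union> R2 \<union> R3 \<subseteq> R" "R \<subseteq> E" unfolding R using sub by auto
  show "f = d" if "d \<in> R1" "f \<in> R1 \<union> R2" "snd f = snd d" for d f
    using set_colouring(2)[OF finite_E c, of d f] that R1D R2B by blast
  have at: "e \<in> fst (s (fst e)) \<union> fst (snd (s (fst e))) \<union> snd (snd (s (fst e)))" "fst e \<in> V1"
    if e: "e \<in> R1 \<union> R2 \<union> R3" for e
  proof -
    obtain u where u: "u \<in> V1" "e \<in> fst (s u) \<union> fst (snd (s u)) \<union> snd (snd (s u))"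
      using e unfolding R1 R2 R3 by blast
    then have "fst e = u" using 1[OF u(1)] by (auto simp: edges_at1_def)
    with u show "e \<in> fst (s (fst e)) \<union> fst (snd (s (fst e))) \<union> snd (snd (s (fst e)))" "fst e \<in> V1" by auto
  qed
  show "e = f" if ef: "e \<in> R1 \<union> R2 \<union> R3" "f \<in> R1 \<union> R2 \<union> R3" "fst e = fst f" for e f
  proof -
    obtain g where g: "fst (s (fst e)) \<union> fst (snd (s (fst e))) \<union> snd (snd (s (fst e))) \<subseteq> {g}"
      using sel(4)[OF at(2)[OF ef(1)] at(2)[OF ef(1)]] by blast
    have "e \<in> {g}" by (rule subsetD[OF g at(1)[OF ef(1)]])
    moreover have "f \<in> {g}" by (rule subsetD[OF g at(1)[OF ef(2), folded ef(3)]])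
    ultimately show ?thesis by simp
  qed
  have "D \<inter> B = {}" using c by (auto simp: colouring_def)
  then show "R1 \<inter> R2 = {}" using R1D R2B by blast
qed

lemma finite_scheme: "finite (set_pmf scheme)"
proof (rule finite_subset)
  show "set_pmf scheme \<subseteq> Pow E \<times> Pow E \<times> Pow E \<times> Pow E"
  proof
    fix p assume p: "p \<in> set_pmf scheme"
    obtain R R1 R2 R3 where pe: "p = (R, R1, R2, R3)" by (cases p)
    have "R1 \<union> R2 \<union> R3 \<subseteq> R" "R \<subseteq> E" using scheme_support(1,2) p unfolding pe by blast+
    then show "p \<in> Pow E \<times> Pow E \<times> Pow E \<times> Pow E" unfolding pe by blast
  qed
  show "finite (Pow E \<times> Pow E \<times> Pow E \<times> Pow E)" using finite_E by simp
qed

text \<open>At a fixed vertex \<open>v\<close> at most one edge lies in \<open>R1\<close>, and then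
  \<open>R2\<close> has none there. So the probabilities of \<open>e \<in> R1\<close> for
  \<open>e \<in> T\<close> and the probability that \<open>R2\<close> meets \<open>T\<close> add
  up.\<close>

lemma scheme_hit:
  assumes v: "v \<in> V2" and T: "T \<subseteq> edges_at2 E v"
  shows "0.509 * sum x T \<le> measure_pmf.prob scheme {(R, R1, R2, R3). (R1 \<union> R2 \<union> R3) \<inter> T \<noteq> {}}"
proof -
  have finT: "finite T" using T finite_edges_at2[OF finite_E] by (rule finite_subset)
  have TE: "e \<in> E" "snd e = v" if "e \<in> T" for e using T that by (auto simp: edges_at2_def)
  have int: "integrable (measure_pmf scheme) f" for f :: "_ \<Rightarrow> real"
    using finite_scheme by (rule integrable_measure_pmf_finite)
  have "sum x T \<le> sum x (edges_at2 E v)"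
    using T finite_edges_at2[OF finite_E] x_bounds by (intro sum_mono2) (auto simp: edges_at2_def less_imp_le)
  also have "\<dots> = 1" using x v by (auto simp: fractional_perfect_matching_def)
  finally have "sum x T \<le> 1" .
  then have "0.509 * sum x T \<le> (1 - exp (- inv_e)) * sum x T
      + measure_pmf.prob scheme {(R, R1, R2, R3). R2 \<inter> T \<noteq> {}}"
    using hit_bound[OF finT, of x] R2_hit[OF v T] x_bounds TE(1) by (force simp: less_imp_le)
  also have "(1 - exp (- inv_e)) * sum x T = (\<Sum>e\<in>T. measure_pmf.prob scheme {(R, R1, R2, R3). e \<in> R1})"
    using R1 TE(1) by (simp add: sum_distrib_left flip: exp_consts(1))
  also have "\<dots> + measure_pmf.prob scheme {(R, R1, R2, R3). R2 \<inter> T \<noteq> {}} =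
      measure_pmf.expectation scheme (\<lambda>(R, R1, R2, R3). (\<Sum>e\<in>T. of_bool (e \<in> R1)) + of_bool (R2 \<inter> T \<noteq> {}))"
    by (simp add: case_prod_unfold int expectation_of_bool_pmf)
  also have "\<dots> \<le> measure_pmf.expectation scheme (\<lambda>(R, R1, R2, R3). of_bool ((R1 \<union> R2 \<union> R3) \<inter> T \<noteq> {}))"
  proof (intro expectation_mono_pmf finite_scheme, clarify)
    fix R R1 R2 R3 assume s: "(R, R1, R2, R3) \<in> set_pmf scheme"
    show "(\<Sum>e\<in>T. of_bool (e \<in> R1)) + of_bool (R2 \<inter> T \<noteq> {}) \<le> (of_bool ((R1 \<union> R2 \<union> R3) \<inter> T \<noteq> {}) :: real)"
    proof (cases "R1 \<inter> T = {}")
      case True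
      then have "(\<Sum>e\<in>T. of_bool (e \<in> R1)) = (0 :: real)" by (intro sum.neutral) auto
      then show ?thesis by auto
    next
      case False
      then obtain d where d: "d \<in> R1" "d \<in> T" by blast
      have only: "f = d" if "f \<in> R1 \<union> R2" "f \<in> T" for f
        using scheme_support(4)[OF s d(1) that(1)] TE(2) d(2) that(2) by simp
      have "(\<Sum>e\<in>T. of_bool (e \<in> R1)) = (\<Sum>e\<in>T. if e = d then 1 else 0 :: real)"
        using only d by (intro sum.cong) auto
      moreover have "R2 \<inter> T = {}" using only scheme_support(5)[OF s] d by blast
      ultimately show ?thesis using d finT by auto
    qed
  qed
  also have "\<dots> = measure_pmf.prob scheme {(R, R1, R2, R3). (R1 \<union> R2 \<union> R3) \<inter> T \<noteq> {}}"
    by (simp add: case_prod_unfold expectation_of_bool_pmf)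
  finally show ?thesis .
qed

section \<open>The selection rules at the vertices of \<open>V2\<close> and the resulting
  matching\<close>

abbreviation selected_at where
  "selected_at v \<equiv> map_pmf (\<lambda>(R, R1, R2, R3). edges_at2 (R1 \<union> R2 \<union> R3) v) scheme"

lemma selection_at_exists:
  assumes v: "v \<in> V2"
  shows "\<exists>\<tau> :: ('a \<times> 'b) set \<Rightarrow> ('a \<times> 'b) option pmf.
     (\<forall>X. X \<subseteq> edges_at2 E v \<longrightarrow> set_pmf (\<tau> X) \<subseteq> insert None (Some ` X)) \<and>
     (\<forall>e\<in>edges_at2 E v. 0.509 * x e \<le> measure_pmf.expectation (selected_at v) (\<lambda>X. pmf (\<tau> X) (Some e)))"
proof (rule selection_exists[OF finite_edges_at2[OF finite_E]])
  show "0 \<le> 0.509 * x e" if "e \<in> edges_at2 E v" for e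
    using x_bounds[of e] that by (auto simp: edges_at2_def)
  show "set_pmf (selected_at v) \<subseteq> Pow (edges_at2 E v)"
    using scheme_support(1,2) by (fastforce simp: edges_at2_def)
  fix T assume T: "T \<subseteq> edges_at2 E v"
  have eq: "edges_at2 S v \<inter> T = S \<inter> T" for S using T by (auto simp: edges_at2_def)
  have "measure_pmf.prob (selected_at v) {X. X \<inter> T \<noteq> {}} =
      measure_pmf.prob scheme {(R, R1, R2, R3). (R1 \<union> R2 \<union> R3) \<inter> T \<noteq> {}}"
    by (simp add: vimage_def case_prod_unfold eq)
  then show "(\<Sum>e\<in>T. 0.509 * x e) \<le> measure_pmf.prob (selected_at v) {X. X \<inter> T \<noteq> {}}"
    using scheme_hit[OF v T] by (simp add: sum_distrib_left)
qed

text \<open>The rules obtained at single vertices are combined independently. Selected edges differ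
  on the side of \<open>V1\<close> by the scheme and on that of \<open>V2\<close> by the single
  choice per vertex; the ratio for \<open>e\<close> involves only the marginal choice at
  \<open>snd e\<close>.\<close>

lemma contention_resolution:
  "\<exists>\<tau> :: 'b \<Rightarrow> ('a \<times> 'b) set \<Rightarrow> ('a \<times> 'b) option pmf.
     partial_selection_rule V2 E \<tau> \<and>
     (\<forall>(R, M) \<in> set_pmf (final_selection V2 \<tau> scheme). M \<subseteq> R \<and> is_matching M) \<and>
     (\<forall>e\<in>E. measure_pmf.prob (final_selection V2 \<tau> scheme) {(R, M). e \<in> M} \<ge> 0.509 * x e)"
proof -
  obtain \<tau> :: "'b \<Rightarrow> ('a \<times> 'b) set \<Rightarrow> ('a \<times> 'b) option pmf" where
    \<tau>: "\<And>v X. v \<in> V2 \<Longrightarrow> X \<subseteq> edges_at2 E v \<Longrightarrow> set_pmf (\<tau> v X) \<subseteq> insert None (Some ` X)"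
    and hit: "\<And>v e. v \<in> V2 \<Longrightarrow> e \<in> edges_at2 E v \<Longrightarrow>
      0.509 * x e \<le> measure_pmf.expectation (selected_at v) (\<lambda>X. pmf (\<tau> v X) (Some e))"
    using selection_at_exists by metis
  let ?m = "\<lambda>S. Pi_pmf V2 None (\<lambda>v. \<tau> v (edges_at2 S v))"
  have "M \<subseteq> R \<and> is_matching M" if RM: "(R, M) \<in> set_pmf (final_selection V2 \<tau> scheme)" for R M
  proof -
    obtain R1 R2 R3 m where s: "(R, R1, R2, R3) \<in> set_pmf scheme"
      and m: "m \<in> set_pmf (?m (R1 \<union> R2 \<union> R3))" and M: "M = {e. \<exists>v\<in>V2. m v = Some e}"
      using RM by (auto simp: final_selection_def)
    let ?S = "R1 \<union> R2 \<union> R3"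
    have SE: "?S \<subseteq> E" using scheme_support(1,2)[OF s] by (rule order_trans)
    have sel: "e \<in> ?S" "snd e = v" if v: "v \<in> V2" and "m v = Some e" for v e
    proof -
      have "edges_at2 ?S v \<subseteq> edges_at2 E v" using SE by (auto simp: edges_at2_def)
      then have "m v \<in> insert None (Some ` edges_at2 ?S v)"
        using \<tau>[OF v] set_Pi_pmfD[OF finite_V2 m v] by blast
      then have "e \<in> edges_at2 ?S v" using \<open>m v = Some e\<close> by auto
      then show "e \<in> ?S" "snd e = v" by (simp_all add: edges_at2_def)
    qed
    have "M \<subseteq> ?S" unfolding M using sel(1) by blast
    moreover have "e = f" if ef: "e \<in> M" "f \<in> M" and eq: "fst e = fst f \<or> snd e = snd f" for e f
      using eq
    proof
      assume "fst e = fst f"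
      then show ?thesis using scheme_support(3)[OF s] ef \<open>M \<subseteq> ?S\<close> by blast
    next
      assume "snd e = snd f"
      moreover obtain v w where "v \<in> V2" "m v = Some e" "w \<in> V2" "m w = Some f" using ef M by blast
      ultimately show ?thesis using sel(2)[of v e] sel(2)[of w f] by simp
    qed
    ultimately show ?thesis using scheme_support(1)[OF s] unfolding is_matching_def by blast
  qed
  moreover have "0.509 * x e \<le> measure_pmf.prob (final_selection V2 \<tau> scheme) {(R, M). e \<in> M}" if e: "e \<in> E" for e
  proof -
    let ?v = "snd e"
    have v: "?v \<in> V2" by (rule snd_in_V2[OF e])
    have "0.509 * x e \<le> measure_pmf.expectation (selected_at ?v) (\<lambda>X. pmf (\<tau> ?v X) (Some e))"
      using e by (intro hit v) (simp add: edges_at2_def)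
    also have "\<dots> = measure_pmf.expectation scheme (\<lambda>(R, R1, R2, R3). pmf (\<tau> ?v (edges_at2 (R1 \<union> R2 \<union> R3) ?v)) (Some e))"
      by (simp add: case_prod_unfold)
    also have "\<dots> \<le> measure_pmf.expectation scheme (\<lambda>(R, R1, R2, R3).
        measure_pmf.prob (?m (R1 \<union> R2 \<union> R3)) {m. \<exists>v\<in>V2. m v = Some e})"
    proof (intro expectation_mono_pmf finite_scheme, clarify)
      fix R R1 R2 R3 :: "('a \<times> 'b) set"
      let ?S = "R1 \<union> R2 \<union> R3"
      have "pmf (\<tau> ?v (edges_at2 ?S ?v)) (Some e) = measure_pmf.prob (map_pmf (\<lambda>m. m ?v) (?m ?S)) {Some e}"
        using finite_V2 v by (simp only: Pi_pmf_component if_True measure_pmf_single)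
      also have "\<dots> = measure_pmf.prob (?m ?S) {m. m ?v = Some e}" by (simp add: vimage_def)
      also have "\<dots> \<le> measure_pmf.prob (?m ?S) {m. \<exists>v\<in>V2. m v = Some e}"
        using v by (intro measure_pmf.finite_measure_mono) auto
      finally show "pmf (\<tau> ?v (edges_at2 ?S ?v)) (Some e) \<le> \<dots>" .
    qed
    also have "\<dots> = measure_pmf.prob (final_selection V2 \<tau> scheme) {(R, M). e \<in> M}"
      unfolding final_selection_def prob_bind_pmf
      by (simp add: case_prod_unfold prob_bind_pmf flip: map_pmf_def)
    finally show ?thesis .
  qed
  ultimately show ?thesis using \<tau> unfolding partial_selection_rule_def by (intro exI[of _ \<tau>]) auto
qed

end

theorem theorem5:
  fixes V1 :: "'a set" and V2 :: "'b set" and E :: "('a \<times> 'b) set"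
    and x \<rho> :: "'a \<times> 'b \<Rightarrow> real"
    and \<sigma>1 \<sigma>2 \<sigma>3 :: "'a \<Rightarrow> ('a \<times> 'b) set \<Rightarrow> ('a \<times> 'b) pmf"
  assumes graph: "bipartite_graph V1 V2 E"
    and x: "fractional_perfect_matching V1 V2 E x"
    and red_prob: "\<forall>e\<in>E. 0 \<le> \<rho> e \<and> \<rho> e \<le> 1"
    and red: "\<forall>e\<in>E. measure_pmf.prob (colouring E x \<rho>) {(D, B, Y). e \<in> D}
                = 1 - exp (- x e / exp 1)"
    and rule1: "selection_rule V1 E \<sigma>1"
    and rule2: "selection_rule V1 E \<sigma>2" "monotone_rule V1 E \<sigma>2"
    and rule3: "selection_rule V1 E \<sigma>3"
    and R1: "\<forall>e\<in>E. measure_pmf.prob (rbg_scheme V1 E x \<rho> \<sigma>1 \<sigma>2 \<sigma>3) {(R, R1, R2, R3). e \<in> R1}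
               = (1 - exp (- 1 / exp 1)) * x e"
    and R2: "\<forall>e\<in>E. measure_pmf.prob (rbg_scheme V1 E x \<rho> \<sigma>1 \<sigma>2 \<sigma>3) {(R, R1, R2, R3). e \<in> R2}
               = (exp (- 1 / exp 1) - exp (- 1)) * x e"
    and R3: "\<forall>e\<in>E. measure_pmf.prob (rbg_scheme V1 E x \<rho> \<sigma>1 \<sigma>2 \<sigma>3) {(R, R1, R2, R3). e \<in> R3}
               \<ge> 1 / (2 * exp 1) * (x e)\<^sup>2"
  shows "\<exists>\<tau> :: 'b \<Rightarrow> ('a \<times> 'b) set \<Rightarrow> ('a \<times> 'b) option pmf.
           partial_selection_rule V2 E \<tau> \<and>
           (\<forall>(R, M) \<in> set_pmf (final_selection V2 \<tau> (rbg_scheme V1 E x \<rho> \<sigma>1 \<sigma>2 \<sigma>3)).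
              M \<subseteq> R \<and> is_matching M) \<and>
           (\<forall>e\<in>E. measure_pmf.prob (final_selection V2 \<tau> (rbg_scheme V1 E x \<rho> \<sigma>1 \<sigma>2 \<sigma>3))
                    {(R, M). e \<in> M} \<ge> 0.509 * x e)"
proof -
  interpret rbg_setting V1 V2 E x \<rho> \<sigma>1 \<sigma>2 \<sigma>3
    using graph x red rule1 rule2 rule3 R1 R2 by unfold_locales auto
  show ?thesis by (rule contention_resolution)
qed

end
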